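(* Let $\{b_n\}_{n=1}^\infty$ and $\{q_n\}_{n=1}^\infty$ be two sequences of integers with $2\le q_n<b_n$ for all $n\ge1$, and let $\mu$ be the associated Moran measure. Then $$\dim_A\mu=\lim_{N\to+\infty}\ \sup_{\substack{k\ge 1,\ n\ge 0\\ q_kb_{k+1}\cdots b_{k+n}\geq N}}\frac{\log (q_k q_{k+1}\cdots q_{k+n})}{\log (q_k b_{k+1}\cdots b_{k+n})}.$$ Equivalently: (i) if $\{q_n\}_{n=1}^{\infty}$ is bounded, then $$\dim_A\mu=\limsup_{n\to+\infty}\ \sup_{k\geq1}\frac{\log (q_kq_{k+1}\cdots q_{k+n})}{\log (b_kb_{k+1}\cdots b_{k+n})};$$ (ii) if $\{q_n\}_{n=1}^{\infty}$ is unbounded, then $\dim_A\mu=1$.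
   Context: Given sequences of integers $\{b_n\}_{n\ge1}$, $\{q_n\}_{n\ge1}$ with $2\le q_n<b_n$, put $\mathcal{D}_k=\{0,1,\ldots,q_k-1\}$ for $k\ge1$. The associated Moran measure is the Borel probability measure on $\mathbb{R}$ given by the infinite convolution (weak limit of the finite convolutions) $$\mu=\delta_{b_1^{-1}\mathcal{D}_1}\ast \delta_{(b_1b_2)^{-1}\mathcal{D}_2}\ast\cdots \ast \delta_{(b_1b_2\cdots b_k)^{-1}\mathcal{D}_k}\ast\cdots,$$ where for a finite set $\mathcal{E}\subset\mathbb{R}$, $\delta_{\mathcal{E}}=\frac{1}{\#\mathcal{E}}\sum_{e\in\mathcal{E}}\delta_e$ and $\delta_e$ is the Dirac measure at $e$. The Assouad dimension $\dim_A\mu$ is the infimum of all $s\ge 0$ for which there exists a constant $C>0$ such that for all $0<r<R<|\mathrm{supp}(\mu)|$ and all $x\in\mathrm{supp}(\mu)$, $\frac{\mu(B(x,R))}{\mu(B(x,r))}\le C\left(\frac{R}{r}\right)^s$, where $|\mathrm{supp}(\mu)|$ is the diameter of the support of $\mu$ and $B(x,r)$ is the ball of center $x$ and radius $r$. For $n=0$ the product $q_kb_{k+1}\cdots b_{k+n}$ means $q_k$, and $q_kq_{k+1}\cdots q_{k+n}$ means $q_k$. *)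

theory Defs
  imports "HOL-Probability.Probability"
begin

subsection \<open>Moran measures\<close>

definition uniform_discrete :: "real set \<Rightarrow> real measure" where
  "uniform_discrete E = distr (measure_pmf (pmf_of_set E)) borel (\<lambda>x. x)"

lemma emeasure_uniform_discrete:
  assumes "finite E" "E \<noteq> {}" "A \<in> sets borel"
  shows "emeasure (uniform_discrete E) A = (\<Sum>e\<in>E. emeasure (return borel e) A) / of_nat (card E)"
proof -
  have "emeasure (uniform_discrete E) A = emeasure (measure_pmf (pmf_of_set E)) A"
    using assms by (simp add: uniform_discrete_def emeasure_distr)
  also have "\<dots> = of_nat (card (E \<inter> A)) / of_nat (card E)"
    using assms by (simp add: emeasure_pmf_of_set ennreal_of_nat_eq_real_of_nat divide_ennreal card_gt_0_iff)
  also have "(of_nat (card (E \<inter> A)) :: ennreal) = (\<Sum>e\<in>E. emeasure (return borel e) A)"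
    using assms by (simp add: sum.inter_restrict[symmetric] indicator_def sum.If_cases Int_def)
  finally show ?thesis .
qed

definition moran_digits :: "(nat \<Rightarrow> int) \<Rightarrow> (nat \<Rightarrow> int) \<Rightarrow> nat \<Rightarrow> real set" where
  "moran_digits b q k = (\<lambda>d. real_of_int d / real_of_int (\<Prod>i=1..k. b i)) ` {0..q k - 1}"

text \<open>The empty convolution is the Dirac measure at 0.  Sequences are indexed from 1; their
  value at 0 is never used.\<close>

primrec moran_convolution :: "(nat \<Rightarrow> int) \<Rightarrow> (nat \<Rightarrow> int) \<Rightarrow> nat \<Rightarrow> real measure" where
  "moran_convolution b q 0 = return borel 0"
| "moran_convolution b q (Suc n) =
     (moran_convolution b q n \<star> uniform_discrete (moran_digits b q (Suc n)))"

definition moran_measure :: "(nat \<Rightarrow> int) \<Rightarrow> (nat \<Rightarrow> int) \<Rightarrow> real measure" where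
  "moran_measure b q =
     (THE \<mu>. real_distribution \<mu> \<and> weak_conv_m (moran_convolution b q) \<mu>)"


subsection \<open>Support and Assouad dimension of a measure\<close>

definition measure_support :: "'a::topological_space measure \<Rightarrow> 'a set" where
  "measure_support M = {x. \<forall>U. open U \<longrightarrow> x \<in> U \<longrightarrow> emeasure M U > 0}"

text \<open>The library constant \<^const>\<open>diameter\<close> is only meaningful for bounded sets, so this is
  intended for measures with bounded support.  The infimum is taken in the extended reals, so the
  dimension is \<open>\<infinity>\<close> if no exponent is admissible.\<close>

definition assouad_dim :: "'a::metric_space measure \<Rightarrow> ereal" where
  "assouad_dim M = Inf {ereal s | s. 0 \<le> s \<and>
     (\<exists>C>0. \<forall>x\<in>measure_support M. \<forall>r R. 0 < r \<and> r < R \<and> R < diameter (measure_support M) \<longrightarrow>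
        measure M (ball x R) / measure M (ball x r) \<le> C * (R / r) powr s)}"


subsection \<open>Well-definedness of the Moran measure\<close>

lemma real_distribution_uniform_discrete: "real_distribution (uniform_discrete E)"
  unfolding uniform_discrete_def real_distribution_def real_distribution_axioms_def
  by (auto intro!: prob_space.prob_space_distr prob_space_measure_pmf)

lemma real_distribution_convolution:
  assumes "real_distribution M" "real_distribution N"
  shows "real_distribution (M \<star> N)"
proof -
  interpret M: real_distribution M by fact
  interpret N: real_distribution N by fact
  interpret P: pair_prob_space M N ..
  have "prob_space (M \<star> N)"
    unfolding convolution_def by (rule P.prob_space_distr) simp
  then show ?thesis
    by (simp add: real_distribution_def real_distribution_axioms_def)
qed

lemma char_convolution:
  assumes "real_distribution M" "real_distribution N"
  shows "char (M \<star> N) t = char M t * char N t"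
proof -
  interpret M: real_distribution M by fact
  interpret N: real_distribution N by fact
  interpret P: pair_prob_space M N ..
  have "char (M \<star> N) t = (CLINT z|M \<Otimes>\<^sub>M N. iexp (t * (fst z + snd z)))"
    unfolding char_def convolution_def
    by (subst integral_distr) (auto simp: case_prod_beta)
  also have "\<dots> = (CLINT x|M. CLINT y|N. iexp (t * (x + y)))"
    by (subst P.integral_fst'[symmetric])
       (auto intro!: P.integrable_const_bound[where B = 1] simp del: of_real_add of_real_mult)
  also have "\<dots> = (CLINT x|M. CLINT y|N. iexp (t * x) * iexp (t * y))"
    by (simp add: distrib_left exp_add)
  also have "\<dots> = char M t * char N t"
    by (simp add: char_def)
  finally show ?thesis .
qed

lemma real_distribution_moran_convolution: "real_distribution (moran_convolution b q n)"
proof (induction n)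
  case 0
  show ?case
    by (simp add: real_distribution_def real_distribution_axioms_def prob_space_return)
next
  case (Suc n)
  then show ?case
    by (simp add: real_distribution_convolution real_distribution_uniform_discrete)
qed

lemma char_moran_convolution:
  "char (moran_convolution b q n) t = (\<Prod>k<n. char (uniform_discrete (moran_digits b q (Suc k))) t)"
proof (induction n)
  case 0
  show ?case by (simp add: char_def integral_return)
next
  case (Suc n)
  then show ?case
    by (simp add: char_convolution real_distribution_moran_convolution
        real_distribution_uniform_discrete)
qed

lemma prod_ge_power2:
  fixes b :: "nat \<Rightarrow> int"
  assumes "\<And>n. n \<ge> 1 \<Longrightarrow> 2 \<le> b n"
  shows "2 ^ n \<le> (\<Prod>i=1..n. b i)"
proof (induction n)
  case (Suc n)
  have "2 ^ n * 2 \<le> (\<Prod>i=1..n. b i) * b (Suc n)"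
    using Suc assms[of "Suc n"] order_trans[OF _ Suc, of 0] by (intro mult_mono) auto
  then show ?case by (simp add: mult.commute)
qed simp

lemma moran_digits_bounds:
  assumes "\<And>n. n \<ge> 1 \<Longrightarrow> 2 \<le> q n \<and> q n < b n" and x: "x \<in> moran_digits b q (Suc k)"
  shows "0 \<le> x" "x \<le> (1/2) ^ k"
proof -
  obtain d where d: "0 \<le> d" "d \<le> q (Suc k) - 1"
      "x = real_of_int d / real_of_int (\<Prod>i=1..Suc k. b i)"
    using x by (auto simp: moran_digits_def)
  have b2: "\<And>n. n \<ge> 1 \<Longrightarrow> 2 \<le> b n" using assms(1) by force
  have P: "2 ^ k \<le> (\<Prod>i=1..k. b i)" using b2 by (rule prod_ge_power2)
  then have P0: "0 < (\<Prod>i=1..k. b i)" by (meson less_le_trans zero_less_numeral zero_less_power)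
  have bS: "d \<le> b (Suc k)" "0 < b (Suc k)" using assms(1)[of "Suc k"] d by auto
  have "0 < (\<Prod>i=1..Suc k. b i)" using P0 bS by simp
  then show "0 \<le> x" using d by (simp del: of_int_prod prod.cl_ivl_Suc)
  have "x \<le> 1 / real_of_int (\<Prod>i=1..k. b i)"
    using d(3) bS P0 by (simp add: field_simps del: of_int_prod)
  also have "\<dots> \<le> 1 / real_of_int (2 ^ k)"
    using P P0 by (intro divide_left_mono) (auto simp del: of_int_prod of_int_power)
  finally show "x \<le> (1/2) ^ k" by (simp add: power_divide)
qed

lemma ex_moran_measure:
  assumes "\<And>n. n \<ge> 1 \<Longrightarrow> 2 \<le> q n \<and> q n < b n"
  shows "\<exists>\<mu>. real_distribution \<mu> \<and> weak_conv_m (moran_convolution b q) \<mu>"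
proof -
  define D where "D k = uniform_discrete (moran_digits b q (Suc k))" for k
  interpret D: real_distribution "D k" for k
    unfolding D_def by (rule real_distribution_uniform_discrete)
  interpret P: product_prob_space D UNIV ..
  let ?P = "PiM UNIV D"
  have meas[measurable]: "(\<lambda>\<omega>. \<omega> k) \<in> borel_measurable ?P" for k
  proof -
    have "(\<lambda>\<omega>. \<omega> k) \<in> measurable ?P (D k)" by simp
    then show ?thesis by (simp cong: measurable_cong_sets)
  qed
  have comp: "distr ?P borel (\<lambda>\<omega>. \<omega> k) = D k" for k
  proof -
    have "distr ?P borel (\<lambda>\<omega>. \<omega> k) = distr ?P (D k) (\<lambda>\<omega>. \<omega> k)"
      by (rule distr_cong) auto
    also have "\<dots> = D k" by (rule P.PiM_component) simp
    finally show ?thesis .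
  qed
  have indep: "P.indep_vars (\<lambda>_. borel) (\<lambda>k \<omega>. \<omega> k) UNIV"
  proof (subst P.indep_vars_iff_distr_eq_PiM)
    have "distr ?P (PiM UNIV (\<lambda>_. borel)) (\<lambda>x. \<lambda>i\<in>UNIV. x i) = distr ?P ?P (\<lambda>x. x)"
      by (rule distr_cong) (auto intro!: sets_PiM_cong)
    then show "distr ?P (PiM UNIV (\<lambda>_. borel)) (\<lambda>x. \<lambda>i\<in>UNIV. x i) =
        PiM UNIV (\<lambda>i. distr ?P borel (\<lambda>\<omega>. \<omega> i))"
      by (simp add: comp distr_id)
  qed auto
  define S where "S \<omega> = (\<Sum>k. \<omega> k)" for \<omega> :: "nat \<Rightarrow> real"
  have S[measurable]: "S \<in> borel_measurable ?P" unfolding S_def by measurable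
  have char_eq: "char (moran_convolution b q n) t = char (distr ?P borel (\<lambda>\<omega>. \<Sum>k<n. \<omega> k)) t" for n t
  proof -
    have "char (distr ?P borel (\<lambda>\<omega>. \<Sum>k<n. \<omega> k)) t = (\<Prod>k<n. char (distr ?P borel (\<lambda>\<omega>. \<omega> k)) t)"
      by (rule P.char_distr_sum) (rule P.indep_vars_subset[OF indep], simp)
    then show ?thesis by (simp add: char_moran_convolution comp D_def)
  qed
  have fin: "finite (moran_digits b q k)" for k by (simp add: moran_digits_def)
  have ne: "moran_digits b q (Suc k) \<noteq> {}" for k
    using assms[of "Suc k"] by (simp add: moran_digits_def)
  have AE1: "AE x in D k. 0 \<le> x \<and> x \<le> (1/2) ^ k" for k
  proof -
    have "AE x in measure_pmf (pmf_of_set (moran_digits b q (Suc k))). 0 \<le> x \<and> x \<le> (1/2) ^ k"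
      using moran_digits_bounds[OF assms] fin ne by (subst AE_measure_pmf_iff) auto
    then show ?thesis unfolding D_def uniform_discrete_def by (subst AE_distr_iff) auto
  qed
  have "AE \<omega> in ?P. \<forall>k. 0 \<le> \<omega> k \<and> \<omega> k \<le> (1/2) ^ k"
    unfolding AE_all_countable
  proof
    fix k
    show "AE \<omega> in ?P. 0 \<le> \<omega> k \<and> \<omega> k \<le> (1/2) ^ k"
      using AE1[of k]
      by (intro AE_PiM_component[where P = "\<lambda>x. 0 \<le> x \<and> x \<le> (1/2) ^ k" and i = k])
         (auto intro: D.prob_space_axioms)
  qed
  then have lim: "AE \<omega> in ?P. (\<lambda>n. \<Sum>k<n. \<omega> k) \<longlonglongrightarrow> S \<omega>"
  proof eventually_elim
    case (elim \<omega>)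
    have "summable (\<lambda>k. \<omega> k)"
      by (rule summable_comparison_test'[of "\<lambda>k. (1/2::real) ^ k" 0]) (use elim in auto)
    then show ?case unfolding S_def by (rule summable_LIMSEQ)
  qed
  let ?\<mu> = "distr ?P borel S"
  have \<mu>: "real_distribution ?\<mu>"
    by (simp add: real_distribution_def real_distribution_axioms_def P.prob_space_distr)
  have "(\<lambda>n. char (moran_convolution b q n) t) \<longlonglongrightarrow> char ?\<mu> t" for t
  proof -
    have "(\<lambda>n. CLINT \<omega>|?P. iexp (t * (\<Sum>k<n. \<omega> k))) \<longlonglongrightarrow> (CLINT \<omega>|?P. iexp (t * S \<omega>))"
    proof (rule integral_dominated_convergence[where w = "\<lambda>_. 1"])
      show "AE \<omega> in ?P. (\<lambda>n. iexp (t * (\<Sum>k<n. \<omega> k))) \<longlonglongrightarrow> iexp (t * S \<omega>)"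
        using lim by eventually_elim (intro tendsto_intros)
    qed auto
    then show ?thesis unfolding char_eq by (simp add: char_def integral_distr)
  qed
  then have "weak_conv_m (moran_convolution b q) ?\<mu>"
    by (intro levy_continuity real_distribution_moran_convolution \<mu>)
  with \<mu> show ?thesis by blast
qed

lemma moran_measure_unique:
  assumes "real_distribution \<mu>" "weak_conv_m (moran_convolution b q) \<mu>"
    and "real_distribution \<nu>" "weak_conv_m (moran_convolution b q) \<nu>"
  shows "\<mu> = \<nu>"
proof (rule Levy_uniqueness[OF assms(1,3)], rule ext)
  fix t
  show "char \<mu> t = char \<nu> t"
    using levy_continuity1[OF real_distribution_moran_convolution assms(1,2)]
      levy_continuity1[OF real_distribution_moran_convolution assms(3,4)]
    by (rule LIMSEQ_unique)
qed

lemma moran_measure: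
  assumes "\<And>n. n \<ge> 1 \<Longrightarrow> 2 \<le> q n \<and> q n < b n"
  shows "real_distribution (moran_measure b q)"
    and "weak_conv_m (moran_convolution b q) (moran_measure b q)"
proof -
  obtain \<mu> where \<mu>: "real_distribution \<mu>" "weak_conv_m (moran_convolution b q) \<mu>"
    using ex_moran_measure[of q b] assms by blast
  have "real_distribution (moran_measure b q) \<and>
      weak_conv_m (moran_convolution b q) (moran_measure b q)"
    unfolding moran_measure_def
    by (rule theI[of _ \<mu>]) (use \<mu> moran_measure_unique in blast)+
  then show "real_distribution (moran_measure b q)"
    and "weak_conv_m (moran_convolution b q) (moran_measure b q)" by blast+
qed

end

theory Submission
  imports Defs
begin

text \<open>
  Write \<open>P k = b\<^sub>1 \<cdots> b\<^sub>k\<close> and \<open>Q k = q\<^sub>1 \<cdots> q\<^sub>k\<close>.  The measure is the average of \<open>Q k\<close> translates,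
  by points of a \<open>1 / P k\<close>-separated set, of the Moran measure of the shifted sequences scaled by
  \<open>1 / P k\<close>.  Counting the cylinders of level \<open>k\<close> inside and near a ball shows that for
  \<open>1 / P k \<le> R \<le> 1 / P (k - 1)\<close> and \<open>x\<close> in the support, the measure of the ball is
  \<open>min (q k) (R * P k) / Q k\<close> up to a factor \<open>4\<close>.  On the critical pairs of radii
  \<open>R = q k / P k\<close> and \<open>r = 1 / P (k + n)\<close> the quotient of the measures is comparable to
  \<open>q\<^sub>k \<cdots> q\<^sub>k\<^sub>+\<^sub>n\<close>, while \<open>R / r = q\<^sub>k b\<^sub>k\<^sub>+\<^sub>1 \<cdots> b\<^sub>k\<^sub>+\<^sub>n\<close>; every other pair reduces to these for exponents
  \<open>s \<le> 1\<close>, because shrinking \<open>R / r\<close> by a factor shrinks the quotient of the measures by at least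
  the power \<open>s\<close> of that factor.
\<close>

subsection \<open>Convolution with a uniform measure\<close>

lemma real_distribution_distr:
  assumes "real_distribution M" "f \<in> borel_measurable borel"
  shows "real_distribution (distr M borel f)"
proof -
  interpret M: real_distribution M by fact
  have "f \<in> borel_measurable M" using assms(2) by simp
  then show ?thesis
    by (simp add: real_distribution_def real_distribution_axioms_def M.prob_space_distr)
qed

lemma char_uniform_discrete_image:
  assumes "finite A" "A \<noteq> {}" "inj_on f A"
  shows "char (uniform_discrete (f ` A)) t = (\<Sum>a\<in>A. iexp (t * f a)) / of_nat (card A)"
proof -
  have "char (uniform_discrete (f ` A)) t =
      (CLINT x|measure_pmf (pmf_of_set (f ` A)). iexp (t * x))"
    unfolding char_def uniform_discrete_def by (subst integral_distr) auto
  also have "\<dots> = (\<Sum>x\<in>f ` A. iexp (t * x) /\<^sub>R real (card (f ` A)))"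
    using assms by (subst integral_measure_pmf[of "f ` A"]) (auto simp: divide_inverse_commute)
  also have "\<dots> = (\<Sum>x\<in>f ` A. iexp (t * x)) / of_nat (card (f ` A))"
    by (simp add: sum_divide_distrib scaleR_conv_of_real field_simps)
  also have "\<dots> = (\<Sum>a\<in>A. iexp (t * f a)) / of_nat (card A)"
    using assms(3) by (simp add: sum.reindex card_image)
  finally show ?thesis .
qed

lemma char_distr_divide:
  assumes "real_distribution M"
  shows "char (distr M borel (\<lambda>x. x / c)) t = char M (t / c)"
proof -
  interpret M: real_distribution M by fact
  show ?thesis unfolding char_def by (subst integral_distr) auto
qed

lemma emeasure_convolution_uniform_discrete:
  assumes E: "finite E" "E \<noteq> {}" and "real_distribution N" and A: "A \<in> sets borel"
  shows "emeasure (uniform_discrete E \<star> N) A =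
    (\<Sum>e\<in>E. emeasure N {y. e + y \<in> A}) / of_nat (card E)"
proof -
  interpret N: real_distribution N by fact
  interpret U: real_distribution "uniform_discrete E" by (rule real_distribution_uniform_discrete)
  have "emeasure (uniform_discrete E \<star> N) A = (\<integral>\<^sup>+x. emeasure N {y. x + y \<in> A} \<partial>uniform_discrete E)"
    using A by (subst convolution_emeasure)
      (auto simp: N.finite_measure_axioms U.finite_measure_axioms add.commute)
  also have "\<dots> = (\<integral>\<^sup>+x. emeasure N {y. x + y \<in> A} \<partial>measure_pmf (pmf_of_set E))"
  proof -
    have "(\<lambda>x. emeasure N (Pair x -` {(x, y). x + y \<in> A})) \<in> borel_measurable borel"
    proof (rule N.measurable_emeasure_Pair)
      show "{(x, y). x + y \<in> A} \<in> sets (borel \<Otimes>\<^sub>M N)"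
      proof -
        have "(\<lambda>z. fst z + snd z) -` A \<inter> space (borel \<Otimes>\<^sub>M N) \<in> sets (borel \<Otimes>\<^sub>M N)"
          using A by (intro measurable_sets[where A=borel]) auto
        then show ?thesis by (auto simp: vimage_def space_pair_measure case_prod_beta')
      qed
    qed
    then have "(\<lambda>x. emeasure N {y. x + y \<in> A}) \<in> borel_measurable borel"
      by (simp add: vimage_def)
    then show ?thesis unfolding uniform_discrete_def by (subst nn_integral_distr) auto
  qed
  also have "\<dots> = (\<Sum>e\<in>E. emeasure N {y. e + y \<in> A}) / of_nat (card E)"
    using E by (subst nn_integral_pmf_of_set) (auto simp: ennreal_of_nat_eq_real_of_nat)
  finally show ?thesis .
qed

subsection \<open>Self-similar decomposition of the Moran measure\<close>

definition partial_prod :: "(nat \<Rightarrow> int) \<Rightarrow> nat \<Rightarrow> real" where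
  "partial_prod b n = real_of_int (\<Prod>i=1..n. b i)"

lemma partial_prod_0 [simp]: "partial_prod b 0 = 1"
  by (simp add: partial_prod_def)

lemma partial_prod_Suc [simp]:
  "partial_prod b (Suc n) = partial_prod b n * real_of_int (b (Suc n))"
  by (simp add: partial_prod_def)

lemma partial_prod_add:
  "partial_prod b (n + k) = partial_prod b k * partial_prod (\<lambda>i. b (i + k)) n"
  by (induction n) simp_all

text \<open>The numerators of the points of level \<open>n\<close> over the common denominator
  \<open>b\<^sub>1 \<cdots> b\<^sub>n\<close>.\<close>

primrec moran_codes :: "(nat \<Rightarrow> int) \<Rightarrow> (nat \<Rightarrow> int) \<Rightarrow> nat \<Rightarrow> int set" where
  "moran_codes b q 0 = {0}"
| "moran_codes b q (Suc n) =
     (\<lambda>(a, d). a * b (Suc n) + d) ` (moran_codes b q n \<times> {0..q (Suc n) - 1})"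

abbreviation moran_points :: "(nat \<Rightarrow> int) \<Rightarrow> (nat \<Rightarrow> int) \<Rightarrow> nat \<Rightarrow> real set" where
  "moran_points b q n \<equiv> (\<lambda>a. real_of_int a / partial_prod b n) ` moran_codes b q n"

text \<open>The law of what the levels beyond \<open>k\<close> contribute. Writing it as a rescaled
  Moran measure of the shifted sequences makes every result about \<open>moran_measure\<close>
  available for it.\<close>

definition moran_tail :: "(nat \<Rightarrow> int) \<Rightarrow> (nat \<Rightarrow> int) \<Rightarrow> nat \<Rightarrow> real measure" where
  "moran_tail b q k =
     distr (moran_measure (\<lambda>i. b (i + k)) (\<lambda>i. q (i + k))) borel (\<lambda>x. x / partial_prod b k)"

locale moran_sequences =
  fixes b q :: "nat \<Rightarrow> int"
  assumes bounds: "\<And>n. n \<ge> 1 \<Longrightarrow> 2 \<le> q n \<and> q n < b n"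
begin

abbreviation "P \<equiv> partial_prod b"
abbreviation "Q \<equiv> partial_prod q"
abbreviation "\<mu> \<equiv> moran_measure b q"

text \<open>Stated at \<open>Suc n\<close> because the values at index 0 are unconstrained.\<close>

lemma q_ge: "2 \<le> q (Suc n)" and q_less: "q (Suc n) < b (Suc n)" and b_ge: "3 \<le> b (Suc n)"
  using bounds[of "Suc n"] by auto

lemma P_pos [simp]: "0 < P n" and Q_pos [simp]: "0 < Q n"
  by (induction n) (use q_ge b_ge in \<open>auto intro!: mult_pos_pos simp: less_le_trans[OF _ q_ge] less_le_trans[OF _ b_ge]\<close>)

lemma P_nonneg [simp]: "0 \<le> P n" and Q_nonneg [simp]: "0 \<le> Q n"
  by (simp_all add: less_imp_le)

lemma P_nz [simp]: "P n \<noteq> 0" and Q_nz [simp]: "Q n \<noteq> 0"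
  using P_pos[of n] Q_pos[of n] by linarith+

lemma shift: "moran_sequences (\<lambda>i. b (i + k)) (\<lambda>i. q (i + k))"
  using bounds by unfold_locales auto

lemma finite_codes [simp]: "finite (moran_codes b q n)"
  by (induction n) auto

lemma zero_in_codes: "0 \<in> moran_codes b q n"
proof (induction n)
  case (Suc n)
  then show ?case using q_ge[of n] by (auto intro!: image_eqI[where x="(0,0)"])
qed simp

lemma codes_nonempty [simp]: "moran_codes b q n \<noteq> {}"
  using zero_in_codes by blast

text \<open>Since \<open>0 \<le> d < b (Suc n)\<close>, the pair \<open>(a, d)\<close> is recovered
  as quotient and remainder of division by \<open>b (Suc n)\<close>.\<close>

lemma inj_codes_step:
  "inj_on (\<lambda>(a, d). a * b (Suc n) + d) (A \<times> {0..q (Suc n) - 1})"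
proof (rule inj_onI)
  let ?D = "{0..q (Suc n) - 1}" and ?f = "\<lambda>(a, d). a * b (Suc n) + d"
  fix x y
  assume xy: "x \<in> A \<times> ?D" "y \<in> A \<times> ?D" "?f x = ?f y"
  have "?f z div b (Suc n) = fst z" if "z \<in> A \<times> ?D" for z
    using that q_less[of n] by (cases z) (auto simp: div_mult_self3)
  with xy have "fst x = fst y" by metis
  with xy show "x = y" by (cases x; cases y) simp
qed

lemma card_codes: "real (card (moran_codes b q n)) = Q n"
proof (induction n)
  case (Suc n)
  have "card (moran_codes b q (Suc n)) = card (moran_codes b q n) * nat (q (Suc n))"
    by (simp add: card_image[OF inj_codes_step] card_cartesian_product)
  then show ?case using Suc q_ge[of n] by simp
qed simp

lemma inj_points: "inj_on (\<lambda>a. real_of_int a / P n) A"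
  by (auto intro!: inj_onI)

text \<open>The product of the exponential sums over level \<open>n\<close> and over the new digits
  expands into a sum over pairs \<open>(a, d)\<close>. By \<open>inj_codes_step\<close> each code of
  level \<open>Suc n\<close> arises exactly once, so the weights stay uniform.\<close>

lemma char_points:
  "char (uniform_discrete (moran_points b q n)) t = char (moran_convolution b q n) t"
proof (induction n)
  case 0
  show ?case using char_uniform_discrete_image[of "{0}" "\<lambda>a. a" t]
    by (simp add: char_def integral_return)
next
  case (Suc n)
  let ?D = "{0..q (Suc n) - 1}"
  let ?f = "\<lambda>n a. real_of_int a / P n"
  have D: "finite ?D" "?D \<noteq> {}" using q_ge[of n] by auto
  have dig: "moran_digits b q (Suc n) = ?f (Suc n) ` ?D"
    by (simp add: moran_digits_def partial_prod_def)
  have "char (moran_convolution b q (Suc n)) t =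
      char (uniform_discrete (moran_points b q n)) t * char (uniform_discrete (?f (Suc n) ` ?D)) t"
    using Suc dig by (simp add: char_convolution real_distribution_moran_convolution
        real_distribution_uniform_discrete)
  also have "\<dots> = (\<Sum>a\<in>moran_codes b q n. iexp (t * ?f n a)) / of_nat (card (moran_codes b q n)) *
      ((\<Sum>d\<in>?D. iexp (t * ?f (Suc n) d)) / of_nat (card ?D))"
    by (simp only: char_uniform_discrete_image[OF D inj_points]
        char_uniform_discrete_image[OF finite_codes codes_nonempty inj_points])
  also have "\<dots> = (\<Sum>a\<in>moran_codes b q n. \<Sum>d\<in>?D. iexp (t * ?f n a) * iexp (t * ?f (Suc n) d)) /
      (of_nat (card (moran_codes b q n)) * of_nat (card ?D))"
    by (simp only: sum_product times_divide_times_eq)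
  also have "\<dots> = (\<Sum>(a, d)\<in>moran_codes b q n \<times> ?D. iexp (t * ?f (Suc n) (a * b (Suc n) + d))) /
      of_nat (card (moran_codes b q n \<times> ?D))"
  proof -
    have "iexp (t * ?f n a) * iexp (t * ?f (Suc n) d) = iexp (t * ?f (Suc n) (a * b (Suc n) + d))"
      for a d
    proof -
      have "t * ?f n a + t * ?f (Suc n) d = t * ?f (Suc n) (a * b (Suc n) + d)"
        using b_ge[of n] by (simp add: field_simps)
      then show ?thesis by (metis exp_add of_real_add distrib_left)
    qed
    then show ?thesis by (simp only: sum.cartesian_product card_cartesian_product of_nat_mult)
  qed
  also have "\<dots> = char (uniform_discrete (moran_points b q (Suc n))) t"
  proof -
    let ?h = "\<lambda>(a, d). a * b (Suc n) + d"
    have "(\<Sum>a\<in>moran_codes b q (Suc n). iexp (t * ?f (Suc n) a)) =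
        (\<Sum>(a, d)\<in>moran_codes b q n \<times> ?D. iexp (t * ?f (Suc n) (a * b (Suc n) + d)))"
      unfolding moran_codes.simps sum.reindex[OF inj_codes_step] by (rule sum.cong) auto
    moreover have "card (moran_codes b q (Suc n)) = card (moran_codes b q n \<times> ?D)"
      by (simp add: card_image[OF inj_codes_step])
    ultimately show ?thesis
      by (simp only: char_uniform_discrete_image[OF finite_codes codes_nonempty inj_points])
  qed
  finally show ?case by simp
qed

lemma moran_convolution_eq: "moran_convolution b q n = uniform_discrete (moran_points b q n)"
  by (rule Levy_uniqueness)
    (auto simp: real_distribution_moran_convolution real_distribution_uniform_discrete char_points)

lemma moran_dist: "real_distribution \<mu>"
  using moran_measure(1) bounds .

lemma moran_weak_conv: "weak_conv_m (moran_convolution b q) \<mu>"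
  using moran_measure(2) bounds .

lemma tail_dist: "real_distribution (moran_tail b q k)"
  unfolding moran_tail_def
  by (rule real_distribution_distr[OF moran_sequences.moran_dist[OF shift]]) simp

text \<open>The characteristic function of the convolution of level \<open>n + k\<close> at
  \<open>t\<close> splits into that of the first \<open>k\<close> levels at \<open>t\<close> and
  that of the shifted sequences at \<open>t / P k\<close>. Levy continuity carries this to the limit
  in \<open>n\<close>.\<close>

lemma moran_eq_convolution_tail: "\<mu> = (uniform_discrete (moran_points b q k) \<star> moran_tail b q k)"
proof (rule Levy_uniqueness)
  show "real_distribution \<mu>" by (rule moran_dist)
  show "real_distribution (uniform_discrete (moran_points b q k) \<star> moran_tail b q k)"
    by (intro real_distribution_convolution real_distribution_uniform_discrete tail_dist)
  let ?b = "\<lambda>i. b (i + k)" and ?q = "\<lambda>i. q (i + k)"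
  interpret S: moran_sequences ?b ?q by (rule shift)
  show "char \<mu> = char (uniform_discrete (moran_points b q k) \<star> moran_tail b q k)"
  proof
    fix t
    have step: "char (uniform_discrete (moran_digits b q (Suc (n + k)))) t =
        char (uniform_discrete (moran_digits ?b ?q (Suc n))) (t / P k)" for n
    proof -
      let ?D = "{0..q (Suc (n + k)) - 1}"
      have D: "finite ?D" "?D \<noteq> {}" using q_ge[of "n + k"] by auto
      have "char (uniform_discrete (moran_digits b q (Suc (n + k)))) t =
          (\<Sum>a\<in>?D. iexp (t * (real_of_int a / P (Suc (n + k))))) / of_nat (card ?D)"
        unfolding moran_digits_def partial_prod_def[symmetric]
        by (rule char_uniform_discrete_image[OF D inj_points])
      moreover have "char (uniform_discrete (moran_digits ?b ?q (Suc n))) (t / P k) =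
          (\<Sum>a\<in>?D. iexp (t / P k * (real_of_int a / S.P (Suc n)))) / of_nat (card ?D)"
        unfolding moran_digits_def partial_prod_def[of ?b, symmetric] add_Suc
        by (rule char_uniform_discrete_image[OF D S.inj_points])
      moreover have "t / P k * (real_of_int a / S.P (Suc n)) = t * (real_of_int a / P (Suc (n + k)))" for a
        by (simp add: partial_prod_add)
      ultimately show ?thesis by (simp only: add_Suc)
    qed
    have prod: "char (moran_convolution b q (n + k)) t =
        char (moran_convolution b q k) t * char (moran_convolution ?b ?q n) (t / P k)" for n
      by (induction n) (simp_all add: char_convolution real_distribution_moran_convolution
        real_distribution_uniform_discrete step char_def[of "return _ _"] integral_return prob_space.prob_space)
    have "(\<lambda>n. char (moran_convolution b q (n + k)) t) \<longlonglongrightarrow> char \<mu> t"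
      by (rule LIMSEQ_ignore_initial_segment)
        (rule levy_continuity1[OF real_distribution_moran_convolution moran_dist moran_weak_conv])
    moreover have "(\<lambda>n. char (moran_convolution b q (n + k)) t) \<longlonglongrightarrow>
        char (moran_convolution b q k) t * char S.\<mu> (t / P k)"
      unfolding prod
      by (intro tendsto_intros levy_continuity1[OF real_distribution_moran_convolution S.moran_dist S.moran_weak_conv])
    ultimately have "char \<mu> t = char (moran_convolution b q k) t * char S.\<mu> (t / P k)"
      by (rule LIMSEQ_unique)
    also have "char S.\<mu> (t / P k) = char (moran_tail b q k) t"
      by (simp add: moran_tail_def char_distr_divide[OF S.moran_dist])
    also have "char (moran_convolution b q k) t * \<dots> =
        char (uniform_discrete (moran_points b q k) \<star> moran_tail b q k) t"
      by (simp add: char_convolution real_distribution_uniform_discrete tail_dist char_points)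
    finally show "char \<mu> t = char (uniform_discrete (moran_points b q k) \<star> moran_tail b q k) t" .
  qed
qed

text \<open>The counting formula behind the ball estimates: each code of level \<open>k\<close>
  contributes the share of its cylinder that lies in \<open>A\<close>, with weight
  \<open>1 / Q k\<close>.\<close>

lemma measure_moran:
  assumes "A \<in> sets borel"
  shows "measure \<mu> A =
    (\<Sum>a\<in>moran_codes b q k. measure (moran_tail b q k) {y. real_of_int a / P k + y \<in> A}) / Q k"
proof -
  interpret M: real_distribution \<mu> by (rule moran_dist)
  interpret T: real_distribution "moran_tail b q k" by (rule tail_dist)
  let ?g = "\<lambda>e. measure (moran_tail b q k) {y. e + y \<in> A}"
  have "ennreal (measure \<mu> A) = (\<Sum>e\<in>moran_points b q k. ennreal (?g e)) /
      of_nat (card (moran_points b q k))"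
    unfolding M.emeasure_eq_measure[symmetric] T.emeasure_eq_measure[symmetric]
    by (subst moran_eq_convolution_tail[of k])
      (rule emeasure_convolution_uniform_discrete[OF _ _ tail_dist assms], auto)
  also have "\<dots> = ennreal ((\<Sum>a\<in>moran_codes b q k. ?g (real_of_int a / P k)) / Q k)"
    by (simp add: card_image[OF inj_points] sum.reindex[OF inj_points] sum_nonneg card_codes
        ennreal_of_nat_eq_real_of_nat divide_ennreal)
  finally show ?thesis
    by (subst (asm) ennreal_inj) (auto intro!: divide_nonneg_pos sum_nonneg)
qed


section \<open>Location and mass of cylinders\<close>

text \<open>The left side will bound the width of a cylinder of level \<open>k\<close>, while left
  ends are at least \<open>1 / P k\<close> apart; strictness leaves a gap between
  neighbours.\<close>

lemma tail_width_less: "real_of_int (q (Suc k)) / P (Suc k) < 1 / P k"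
proof -
  have "real_of_int (q (Suc k)) < real_of_int (b (Suc k))" using q_less[of k] by simp
  then show ?thesis using b_ge[of k] by (simp add: field_simps)
qed

lemma codes_nonneg: "a \<in> moran_codes b q n \<Longrightarrow> 0 \<le> a"
proof (induction n arbitrary: a)
  case (Suc n)
  then obtain a' d where "a = a' * b (Suc n) + d" "a' \<in> moran_codes b q n" "0 \<le> d" by auto
  then show ?case using Suc.IH b_ge[of n] by simp
qed simp

text \<open>The induction closes for \<open>a + 1\<close> rather than \<open>a\<close>: from
  \<open>d + 1 \<le> q (Suc n) < b (Suc n)\<close> follows
  \<open>a + 1 \<le> (a' + 1) * b (Suc n)\<close> for the parent code \<open>a'\<close>.\<close>

lemma codes_bound:
  "a \<in> moran_codes b q (Suc n) \<Longrightarrow>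
    (real_of_int a + 1) / P (Suc n) \<le> real_of_int (q 1) / real_of_int (b 1)"
proof (induction n arbitrary: a)
  case 0
  then have "a + 1 \<le> q 1" by auto
  then have "real_of_int a + 1 \<le> real_of_int (q 1)" by linarith
  then show ?case using b_ge[of 0] by (simp add: divide_right_mono)
next
  case (Suc n)
  let ?b = "b (Suc (Suc n))"
  obtain a' d where a: "a = a' * ?b + d" "a' \<in> moran_codes b q (Suc n)" "d \<le> q (Suc (Suc n)) - 1"
    using Suc.prems unfolding moran_codes.simps(2)[of b q "Suc n"]
    by (auto simp del: moran_codes.simps)
  have "a + 1 \<le> (a' + 1) * ?b" using a(1,3) q_less[of "Suc n"] by (simp add: algebra_simps)
  then have "real_of_int a + 1 \<le> (real_of_int a' + 1) * real_of_int ?b"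
    by (metis of_int_1 of_int_add of_int_le_iff of_int_mult)
  then have "(real_of_int a + 1) / P (Suc (Suc n)) \<le>
      (real_of_int a' + 1) * real_of_int ?b / P (Suc (Suc n))"
    by (intro divide_right_mono less_imp_le[OF P_pos])
  also have "\<dots> = (real_of_int a' + 1) / P (Suc n)"
    using b_ge[of "Suc n"] by (subst partial_prod_Suc) (simp del: partial_prod_Suc)
  also have "\<dots> \<le> real_of_int (q 1) / real_of_int (b 1)" by (rule Suc.IH[OF a(2)])
  finally show ?case .
qed

text \<open>The bound \<open>q\<^sub>1 / b\<^sub>1\<close> instead of \<open>1\<close> makes neighbouring cylinders of the same level disjoint,
  so that open balls of radius \<open>1 / (b\<^sub>1 \<cdots> b\<^sub>k)\<close> contain whole cylinders.\<close>

lemma AE_moran: "AE x in \<mu>. 0 \<le> x \<and> x \<le> real_of_int (q 1) / real_of_int (b 1)"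
proof -
  interpret M: real_distribution \<mu> by (rule moran_dist)
  define c where "c = real_of_int (q 1) / real_of_int (b 1)"
  \<comment> \<open>A bounded continuous function vanishing exactly on \<open>[0, c]\<close>, so
    that weak convergence can be tested on it.\<close>
  define f where "f x = min 1 (max 0 (- x) + max 0 (x - c))" for x :: real
  have f_meas [measurable]: "f \<in> borel_measurable borel" unfolding f_def by measurable
  have f0: "0 \<le> f x" "f x \<le> 1" for x by (auto simp: f_def)
  have z: "f x = 0 \<longleftrightarrow> 0 \<le> x \<and> x \<le> c" for x by (auto simp: f_def min_def max_def)
  have "(\<lambda>n. integral\<^sup>L (moran_convolution b q n) f) \<longlonglongrightarrow> integral\<^sup>L \<mu> f"
  proof (rule weak_conv_imp_integral_bdd_continuous_conv[OF real_distribution_moran_convolution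
        moran_dist moran_weak_conv])
    show "isCont f x" for x unfolding f_def by (intro continuous_intros)
    show "norm (f x) \<le> 1" for x using f0 by simp
  qed
  moreover have "eventually (\<lambda>n. integral\<^sup>L (moran_convolution b q n) f = 0) sequentially"
    using eventually_ge_at_top[of 1]
  proof eventually_elim
    case (elim n)
    then obtain m where n: "n = Suc m" by (cases n) auto
    have "AE x in measure_pmf (pmf_of_set (moran_points b q n)). f x = 0"
    proof (subst AE_measure_pmf_iff, rule ballI)
      fix e assume "e \<in> set_pmf (pmf_of_set (moran_points b q n))"
      then obtain a where a: "a \<in> moran_codes b q n" "e = real_of_int a / P n" by auto
      have "0 \<le> e" unfolding a(2) using codes_nonneg[OF a(1)]
        by (intro divide_nonneg_pos P_pos) simp
      moreover have "e \<le> (real_of_int a + 1) / P n"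
        unfolding a(2) by (intro divide_right_mono less_imp_le[OF P_pos]) simp
      moreover have "(real_of_int a + 1) / P n \<le> c"
        using codes_bound a(1) unfolding n c_def by blast
      ultimately show "f e = 0" using z by simp
    qed
    then have "(\<integral>x. f x \<partial>measure_pmf (pmf_of_set (moran_points b q n))) = 0"
      by (rule integral_eq_zero_AE)
    then show ?case
      unfolding moran_convolution_eq uniform_discrete_def by (subst integral_distr) auto
  qed
  ultimately have "integral\<^sup>L \<mu> f = 0"
    by (metis LIMSEQ_unique tendsto_eventually)
  moreover have "integrable \<mu> f"
    by (rule M.integrable_const_bound[where B=1]) (use f0 in auto)
  ultimately have "AE x in \<mu>. f x = 0"
    using integral_nonneg_eq_0_iff_AE[of \<mu> f] f0 by simp
  then show ?thesis unfolding z c_def .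
qed

lemma AE_tail: "AE y in moran_tail b q k. 0 \<le> y \<and> y \<le> real_of_int (q (Suc k)) / P (Suc k)"
proof -
  interpret S: moran_sequences "\<lambda>i. b (i + k)" "\<lambda>i. q (i + k)" by (rule shift)
  interpret M: real_distribution S.\<mu> by (rule S.moran_dist)
  have "AE x in S.\<mu>. 0 \<le> x / P k \<and> x / P k \<le> real_of_int (q (Suc k)) / P (Suc k)"
    using S.AE_moran
  proof eventually_elim
    case (elim x)
    then have "x / P k \<le> real_of_int (q (Suc k)) / real_of_int (b (Suc k)) / P k"
      by (intro divide_right_mono less_imp_le[OF P_pos]) simp
    then show ?case using elim by (simp add: mult.commute less_imp_le[OF P_pos])
  qed
  then show ?thesis unfolding moran_tail_def by (subst AE_distr_iff) auto
qed

lemma space_tail [simp]: "space (moran_tail b q k) = UNIV"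
  and sets_tail [simp]: "sets (moran_tail b q k) = sets borel"
  by (simp_all add: moran_tail_def)

lemma tail_shift_sets [simp]: "A \<in> sets borel \<Longrightarrow> {y. e + y \<in> A} \<in> sets borel" for e :: real
proof -
  assume "A \<in> sets borel"
  then have "(\<lambda>y. e + y) -` A \<inter> space borel \<in> sets borel" by (intro measurable_sets[where A=borel]) auto
  then show ?thesis by (simp add: vimage_def)
qed

text \<open>With \<open>e\<close> the left end of a cylinder, this and \<open>tail_eq_1\<close>
  evaluate the summands of \<open>measure_moran\<close> for cylinders that miss \<open>A\<close> or
  lie inside it.\<close>

lemma tail_eq_0:
  assumes "A \<in> sets borel"
    and "\<And>y. 0 \<le> y \<Longrightarrow> y \<le> real_of_int (q (Suc k)) / P (Suc k) \<Longrightarrow> e + y \<notin> A"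
  shows "measure (moran_tail b q k) {y. e + y \<in> A} = 0"
proof -
  interpret T: real_distribution "moran_tail b q k" by (rule tail_dist)
  have "AE y in moran_tail b q k. \<not> (e + y \<in> A)"
    using AE_tail[of k] by eventually_elim (use assms(2) in auto)
  then show ?thesis
    using T.prob_Collect_eq_0[of "\<lambda>y. e + y \<in> A"] assms(1) by simp
qed

lemma tail_eq_1:
  assumes "A \<in> sets borel"
    and "\<And>y. 0 \<le> y \<Longrightarrow> y \<le> real_of_int (q (Suc k)) / P (Suc k) \<Longrightarrow> e + y \<in> A"
  shows "measure (moran_tail b q k) {y. e + y \<in> A} = 1"
proof -
  interpret T: real_distribution "moran_tail b q k" by (rule tail_dist)
  have "AE y in moran_tail b q k. e + y \<in> A"
    using AE_tail[of k] by eventually_elim (use assms(2) in auto)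
  then show ?thesis
    using T.prob_Collect_eq_1[of "\<lambda>y. e + y \<in> A"] assms(1) by simp
qed

subsection \<open>Balls and the support\<close>

lemma measure_ge_card_codes:
  assumes A: "A \<in> sets borel" and J: "J \<subseteq> moran_codes b q k"
    and in_A: "\<And>a y. a \<in> J \<Longrightarrow> 0 \<le> y \<Longrightarrow> y \<le> real_of_int (q (Suc k)) / P (Suc k) \<Longrightarrow>
      real_of_int a / P k + y \<in> A"
  shows "real (card J) / Q k \<le> measure \<mu> A"
proof -
  let ?m = "\<lambda>a. measure (moran_tail b q k) {y. real_of_int a / P k + y \<in> A}"
  have "real (card J) = (\<Sum>a\<in>J. ?m a)"
    using tail_eq_1[OF A in_A] by simp
  also have "\<dots> \<le> (\<Sum>a\<in>moran_codes b q k. ?m a)"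
    using J by (intro sum_mono2) auto
  finally show ?thesis
    unfolding measure_moran[OF A, of k] by (intro divide_right_mono less_imp_le[OF Q_pos])
qed

lemma measure_ball_le: "measure \<mu> (ball x R) \<le> (2 * (P k * R) + 2) / Q k" if "0 < R"
proof -
  interpret T: real_distribution "moran_tail b q k" by (rule tail_dist)
  let ?m = "\<lambda>a. measure (moran_tail b q k) {y. real_of_int a / P k + y \<in> ball x R}"
  let ?w = "real_of_int (q (Suc k)) / P (Suc k)"
  \<comment> \<open>In units of \<open>1 / P k\<close>: a cylinder meeting the ball has its code
    strictly between \<open>u\<close> and \<open>v\<close>. The extra \<open>- 1\<close> allows for
    its width, which is below one unit.\<close>
  define u v where "u = P k * x - P k * R - 1" and "v = P k * x + P k * R"
  let ?J = "{\<lfloor>u\<rfloor><..<\<lceil>v\<rceil>}"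
  have out: "?m a = 0" if "a \<in> moran_codes b q k - ?J" for a
  proof (rule tail_eq_0)
    fix y :: real
    assume y: "0 \<le> y" "y \<le> ?w"
    have "a \<le> \<lfloor>u\<rfloor> \<or> \<lceil>v\<rceil> \<le> a" using that by auto
    then have "real_of_int a \<le> u \<or> v \<le> real_of_int a" by linarith
    then have "real_of_int a / P k + 1 / P k \<le> x - R \<or> x + R \<le> real_of_int a / P k"
      unfolding u_def v_def by (auto simp: field_simps)
    then show "real_of_int a / P k + y \<notin> ball x R"
      using y tail_width_less[of k] by (auto simp: dist_real_def)
  qed simp
  have "(\<Sum>a\<in>moran_codes b q k. ?m a) = (\<Sum>a\<in>moran_codes b q k \<inter> ?J. ?m a)"
    using out by (intro sum.mono_neutral_right) auto
  also have "\<dots> \<le> real (card (moran_codes b q k \<inter> ?J)) * 1"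
    by (rule sum_bounded_above) (rule T.prob_le_1)
  also have "\<dots> \<le> real (card ?J)" by (simp add: card_mono del: card_greaterThanLessThan_int)
  also have "\<dots> \<le> 2 * (P k * R) + 2"
  proof -
    have "0 \<le> P k * R" using \<open>0 < R\<close> less_imp_le[OF P_pos[of k]] by simp
    then have "u \<le> v" unfolding u_def v_def by linarith
    then have "real (card ?J) \<le> max 0 (real_of_int (\<lceil>v\<rceil> - \<lfloor>u\<rfloor> - 1))" by simp
    also have "\<dots> \<le> 2 * (P k * R) + 2"
    proof -
      have "real_of_int (\<lceil>v\<rceil> - \<lfloor>u\<rfloor> - 1) \<le> v - u + 1" by linarith
      moreover have "v - u + 1 = 2 * (P k * R) + 2" by (simp add: u_def v_def)
      ultimately show ?thesis using \<open>0 \<le> P k * R\<close> by (intro max.boundedI) linarith+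
    qed
    finally show ?thesis .
  qed
  finally show ?thesis
    by (subst measure_moran[of _ k]) (simp, intro divide_right_mono less_imp_le[OF Q_pos])
qed

text \<open>Finitely many closed cylinder intervals carry the whole mass, so their complement is an
  open null set and misses the support.\<close>

lemma support_code:
  assumes "x \<in> measure_support \<mu>"
  obtains a where "a \<in> moran_codes b q k" "real_of_int a / P k \<le> x"
    "x \<le> real_of_int a / P k + real_of_int (q (Suc k)) / P (Suc k)"
proof -
  interpret M: real_distribution \<mu> by (rule moran_dist)
  let ?w = "real_of_int (q (Suc k)) / P (Suc k)"
  let ?C = "\<lambda>a. {real_of_int a / P k .. real_of_int a / P k + ?w}"
  define U where "U = - (\<Union>a\<in>moran_codes b q k. ?C a)"
  have U: "open U" unfolding U_def by (intro open_Compl closed_UN) auto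
  then have Um: "U \<in> sets borel" by simp
  have "measure (moran_tail b q k) {y. real_of_int a / P k + y \<in> U} = 0"
    if "a \<in> moran_codes b q k" for a
    using that by (intro tail_eq_0[OF Um]) (auto simp: U_def simp del: partial_prod_Suc intro!: bexI[of _ a])
  then have "measure \<mu> U = 0" using measure_moran[OF Um, of k] by simp
  then have "emeasure \<mu> U = 0" by (simp add: M.emeasure_eq_measure)
  then have "x \<notin> U" using assms U unfolding measure_support_def by force
  then show ?thesis using that unfolding U_def by auto
qed

text \<open>Only siblings of a cylinder of level \<open>Suc k\<close> containing \<open>x\<close>
  are counted: consecutive children of one parent. This is why the bound saturates at
  \<open>q (Suc k)\<close>.\<close>

lemma measure_ball_ge:
  assumes x: "x \<in> measure_support \<mu>" and R: "1 / P (Suc k) \<le> R"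
  shows "min (real_of_int (q (Suc k))) (R * P (Suc k)) / (2 * Q (Suc k)) \<le> measure \<mu> (ball x R)"
proof -
  let ?P = "P (Suc k)" and ?q = "q (Suc k)"
  let ?w = "real_of_int (q (Suc (Suc k))) / P (Suc (Suc k))"
  obtain c where c: "c \<in> moran_codes b q (Suc k)" "real_of_int c / ?P \<le> x" "x \<le> real_of_int c / ?P + ?w"
    using support_code[OF x] by blast
  obtain a d where ad: "c = a * b (Suc k) + d" "a \<in> moran_codes b q k" "0 \<le> d" "d \<le> ?q - 1"
    using c(1) by auto
  define m where "m = min ?q \<lfloor>R * ?P\<rfloor>"
  have RP: "1 \<le> R * ?P" using R by (simp add: field_simps del: partial_prod_Suc)
  then have m1: "1 \<le> m" using q_ge[of k] unfolding m_def by simp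
  \<comment> \<open>First digit of a window of \<open>m\<close> digits that contains
    \<open>d\<close> and stays within \<open>{0..q (Suc k) - 1}\<close>.\<close>
  define s where "s = max 0 (d - m + 1)"
  define J where "J = (\<lambda>i. a * b (Suc k) + i) ` {s..s + m - 1}"
  have s: "0 \<le> s" "s + m - 1 \<le> ?q - 1" "d - m + 1 \<le> s" "s \<le> d"
    unfolding s_def using m1 ad(3,4) by (auto simp: m_def)
  define p where "p = ?P"
  have p: "0 < p" and pR: "1 \<le> R * p" "1 / p \<le> R" and wp: "?w < 1 / p"
    using RP R P_pos[of "Suc k"] tail_width_less[of "Suc k"] unfolding p_def by blast+
  note c = c[folded p_def]
  have "card J = nat m" unfolding J_def by (subst card_image) (auto simp: inj_on_def)
  moreover have "real (card J) / Q (Suc k) \<le> measure \<mu> (ball x R)"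
  proof (rule measure_ge_card_codes)
    show "J \<subseteq> moran_codes b q (Suc k)"
    proof
      fix j assume "j \<in> J"
      then obtain i where "j = a * b (Suc k) + i" "i \<in> {s..s + m - 1}" unfolding J_def by blast
      then show "j \<in> moran_codes b q (Suc k)" unfolding moran_codes.simps
        using s ad(2) by (intro image_eqI[of _ _ "(a, i)"]) auto
    qed
    fix j y assume j: "j \<in> J" and y: "0 \<le> y" "y \<le> ?w"
    obtain i where i: "j = a * b (Suc k) + i" "i \<in> {s..s + m - 1}"
      using j unfolding J_def by blast
    then have "s \<le> i" "i \<le> s + m - 1" by auto
    then have "\<bar>i - d\<bar> \<le> m - 1" using s by linarith
    then have "\<bar>j - c\<bar> \<le> m - 1" using i(1) ad(1) by simp
    moreover have "real_of_int m \<le> R * p"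
      using min.cobounded2[of ?q "\<lfloor>R * p\<rfloor>"] unfolding m_def p_def[symmetric] le_floor_iff .
    \<comment> \<open>The margin of one unit \<open>1 / p\<close> exceeds the width
      \<open>?w\<close> of a cylinder, so whole cylinders fit in the open ball.\<close>
    ultimately have "\<bar>real_of_int j - real_of_int c\<bar> \<le> R * p - 1" by linarith
    then have "\<bar>real_of_int j - real_of_int c\<bar> / p \<le> (R * p - 1) / p"
      using p by (intro divide_right_mono) auto
    also have "\<dots> = R - 1 / p" using p by (simp add: field_simps)
    also have "\<bar>real_of_int j - real_of_int c\<bar> / p = \<bar>real_of_int j / p - real_of_int c / p\<bar>"
      using p by (simp add: diff_divide_distrib[symmetric])
    finally have "\<bar>real_of_int j / p - real_of_int c / p\<bar> \<le> R - 1 / p" .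
    moreover have "\<bar>x - real_of_int c / p - y\<bar> \<le> ?w" using y c(2,3) unfolding abs_le_iff by linarith
    ultimately have "\<bar>x - (real_of_int j / p + y)\<bar> < R" using wp by linarith
    then show "real_of_int j / ?P + y \<in> ball x R" unfolding p_def[symmetric] by (simp add: dist_real_def)
  qed simp
  ultimately have "real_of_int m / Q (Suc k) \<le> measure \<mu> (ball x R)" using m1 by simp
  moreover have "min (real_of_int ?q) (R * p) / (2 * Q (Suc k)) \<le> real_of_int m / Q (Suc k)"
  proof -
    \<comment> \<open>Rounding down a number that is at least 1 loses at most a factor 2.\<close>
    have "R * p < real_of_int \<lfloor>R * p\<rfloor> + 1" "1 \<le> \<lfloor>R * p\<rfloor>" using pR by linarith+
    then have "R * p \<le> 2 * real_of_int \<lfloor>R * p\<rfloor>" by linarith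
    moreover have "0 \<le> real_of_int ?q" using q_ge[of k] by linarith
    ultimately have "min (real_of_int ?q) (R * p) \<le> 2 * real_of_int m"
      unfolding m_def p_def[symmetric] of_int_min min_def by auto
    then have "min (real_of_int ?q) (R * p) / (2 * Q (Suc k)) \<le> 2 * real_of_int m / (2 * Q (Suc k))"
      using Q_pos[of "Suc k"] by (intro divide_right_mono) linarith+
    then show ?thesis by simp
  qed
  ultimately show ?thesis unfolding p_def by linarith
qed

text \<open>Counting at level \<open>Suc k\<close> gives the term \<open>R * P (Suc k)\<close>,
  counting at level \<open>k\<close> gives the saturated term \<open>q (Suc k)\<close>.\<close>

lemma measure_ball_le_min:
  assumes "1 / P (Suc k) \<le> R" "R \<le> 1 / P k"
  shows "measure \<mu> (ball x R) \<le>
    4 * min (real_of_int (q (Suc k))) (R * P (Suc k)) / Q (Suc k)"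
proof -
  have R0: "0 < R" using assms(1) P_pos[of "Suc k"] by (meson divide_pos_pos less_le_trans zero_less_one)
  have "measure \<mu> (ball x R) \<le> (2 * (P (Suc k) * R) + 2) / Q (Suc k)" by (rule measure_ball_le[OF R0])
  also have "\<dots> \<le> 4 * (R * P (Suc k)) / Q (Suc k)"
  proof (intro divide_right_mono less_imp_le[OF Q_pos])
    have "1 \<le> R * P (Suc k)" using assms(1) by (simp add: field_simps del: partial_prod_Suc)
    then show "2 * (P (Suc k) * R) + 2 \<le> 4 * (R * P (Suc k))" by (simp add: mult.commute del: partial_prod_Suc)
  qed
  finally have 1: "measure \<mu> (ball x R) \<le> 4 * (R * P (Suc k)) / Q (Suc k)" .
  have "measure \<mu> (ball x R) \<le> (2 * (P k * R) + 2) / Q k" by (rule measure_ball_le[OF R0])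
  also have "\<dots> \<le> 4 / Q k"
    using assms(2) by (intro divide_right_mono less_imp_le[OF Q_pos]) (simp add: field_simps)
  also have "\<dots> = 4 * real_of_int (q (Suc k)) / Q (Suc k)" using q_ge[of k] by simp
  finally show ?thesis using 1 by (simp add: min_def del: partial_prod_Suc)
qed

section \<open>Points and diameter of the support\<close>

lemma P_ge_power2: "2 ^ n \<le> P n"
proof -
  have "2 ^ n \<le> (\<Prod>i=1..n. b i)" using bounds by (intro prod_ge_power2) force
  then show ?thesis unfolding partial_prod_def by (metis of_int_le_iff of_int_numeral of_int_power)
qed

lemma ex_inverse_P_less: "0 < e \<Longrightarrow> \<exists>n. 1 / P n < e"
proof -
  assume e: "0 < e"
  obtain n where "1 / e < 2 ^ n" using real_arch_pow[of 2 "1/e"] by auto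
  then have "1 / e < P n" using P_ge_power2[of n] by linarith
  then show ?thesis using e by (intro exI[of _ n]) (simp add: field_simps)
qed

text \<open>Appending the digit 0 does not move a point.\<close>

lemma points_mono: "moran_points b q k \<subseteq> moran_points b q (k + j)"
proof (induction j)
  case (Suc j)
  let ?n = "k + j"
  have "moran_points b q ?n \<subseteq> moran_points b q (Suc ?n)"
  proof (rule image_subsetI, rule image_eqI)
    fix a assume a: "a \<in> moran_codes b q ?n"
    show "a * b (Suc ?n) + 0 \<in> moran_codes b q (Suc ?n)"
      unfolding moran_codes.simps using a q_ge[of ?n] by (intro image_eqI[of _ _ "(a, 0)"]) auto
    show "real_of_int a / P ?n = real_of_int (a * b (Suc ?n) + 0) / P (Suc ?n)"
      using b_ge[of ?n] by simp
  qed
  with Suc show ?case unfolding add_Suc_right by (rule subset_trans)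
qed simp

lemma antimono_inverse_P: "m \<le> n \<Longrightarrow> 1 / P n \<le> 1 / P m"
proof (induction n rule: dec_induct)
  case (step n)
  have "1 / P (Suc n) \<le> real_of_int (q (Suc n)) / P (Suc n)"
    using q_ge[of n] by (intro divide_right_mono less_imp_le[OF P_pos]) simp
  then show ?case using step tail_width_less[of n] by linarith
qed simp

text \<open>By \<open>points_mono\<close> the point is also the left end of arbitrarily short
  cylinders, each of positive mass.\<close>

lemma points_subset_support: "moran_points b q k \<subseteq> measure_support \<mu>"
proof
  interpret M: real_distribution \<mu> by (rule moran_dist)
  fix e assume e: "e \<in> moran_points b q k"
  show "e \<in> measure_support \<mu>" unfolding measure_support_def
  proof (clarify)
    fix U :: "real set" assume U: "open U" "e \<in> U"
    then obtain \<epsilon> where eps: "0 < \<epsilon>" "ball e \<epsilon> \<subseteq> U" by (meson openE)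
    obtain j where j: "1 / P j < \<epsilon>" using ex_inverse_P_less[OF eps(1)] by blast
    obtain a where a: "a \<in> moran_codes b q (k + j)" "e = real_of_int a / P (k + j)"
      using e points_mono[of k j] by blast
    have "real (card {a}) / Q (k + j) \<le> measure \<mu> U"
    proof (rule measure_ge_card_codes)
      fix a' y assume *: "a' \<in> {a}" "0 \<le> y" "y \<le> real_of_int (q (Suc (k + j))) / P (Suc (k + j))"
      have "y < \<epsilon>" using * tail_width_less[of "k + j"] antimono_inverse_P[of j "k + j"] j by linarith
      then show "real_of_int a' / P (k + j) + y \<in> U" using * a(2) eps(2) by (auto simp: dist_real_def)
    qed (use U a in auto)
    moreover have "0 < real (card {a}) / Q (k + j)" by simp
    ultimately have "0 < measure \<mu> U" by linarith
    then show "0 < emeasure \<mu> U" by (simp add: M.emeasure_eq_measure)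
  qed
qed

lemma zero_in_support: "0 \<in> measure_support \<mu>"
  using points_subset_support[of 0] by (simp add: image_subset_iff)

lemma support_subset: "measure_support \<mu> \<subseteq> {0..1}"
proof
  fix x assume "x \<in> measure_support \<mu>"
  then show "x \<in> {0..1}"
    by (rule support_code[where k = 0]) (use tail_width_less[of 0] in auto)
qed

lemma diameter_support_le: "diameter (measure_support \<mu>) \<le> 1"
proof (rule diameter_le)
  fix x y assume "x \<in> measure_support \<mu>" "y \<in> measure_support \<mu>"
  then have "x \<in> {0..1}" "y \<in> {0..1}" using support_subset by blast+
  then show "norm (x - y) \<le> 1" by (auto simp: abs_le_iff)
qed simp

text \<open>Ensures that the radii tested in \<open>digit_prod_le_of_ball_ratio\<close> lie below
  the diameter.\<close>

lemma diameter_support_greater: "real_of_int (q 1) / (2 * real_of_int (b 1)) < diameter (measure_support \<mu>)"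
proof -
  let ?q = "real_of_int (q 1)" and ?b = "real_of_int (b 1)" and ?b' = "real_of_int (b 2)"
  have 1: "q 1 \<ge> 2" "q 2 \<ge> 2" "b 1 > 0" "b 2 > 0" using bounds[of 1] bounds[of 2] by auto
  \<comment> \<open>The last digit at level 1 followed by the digit 1 at level 2. The second digit
    gives strictness when \<open>q 1 = 2\<close>, where \<open>(q 1 - 1) / b 1\<close> equals the
    bound.\<close>
  define e where "e = real_of_int ((q 1 - 1) * b 2 + 1) / P 2"
  have "q 1 - 1 \<in> moran_codes b q 1" using 1 by (auto intro!: image_eqI[of _ _ "(0, q 1 - 1)"])
  then have "(q 1 - 1) * b 2 + 1 \<in> moran_codes b q 2"
    unfolding numeral_2_eq_2 moran_codes.simps(2)[of b q "Suc 0"]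
    using 1 by (intro image_eqI[of _ _ "(q 1 - 1, 1)"]) (auto simp: numeral_2_eq_2)
  then have "e \<in> measure_support \<mu>" using points_subset_support[of 2] by (auto simp: e_def)
  moreover have "0 \<in> measure_support \<mu>" by (rule zero_in_support)
  moreover have "bounded (measure_support \<mu>)" using support_subset bounded_closed_interval bounded_subset by blast
  ultimately have "dist e 0 \<le> diameter (measure_support \<mu>)" by (intro diameter_bounded_bound)
  moreover have "e = (?q - 1) / ?b + 1 / (?b * ?b')"
    using 1 by (simp add: e_def numeral_2_eq_2 field_simps)
  moreover have "?q / (2 * ?b) \<le> (?q - 1) / ?b" using 1 by (simp add: field_simps)
  moreover have "0 < 1 / (?b * ?b')" using 1 by simp
  ultimately show ?thesis unfolding dist_real_def by linarith
qed

end


subsection \<open>The Assouad dimension\<close>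

definition digit_prod :: "(nat \<Rightarrow> int) \<Rightarrow> nat \<Rightarrow> nat \<Rightarrow> real" where
  "digit_prod q k n = real_of_int (\<Prod>i=k..k+n. q i)"

definition scale_ratio :: "(nat \<Rightarrow> int) \<Rightarrow> (nat \<Rightarrow> int) \<Rightarrow> nat \<Rightarrow> nat \<Rightarrow> real" where
  "scale_ratio b q k n = real_of_int (q k * (\<Prod>i=k+1..k+n. b i))"

definition moran_rate :: "(nat \<Rightarrow> int) \<Rightarrow> (nat \<Rightarrow> int) \<Rightarrow> nat \<Rightarrow> ereal" where
  "moran_rate b q N =
    (SUP (k, n) \<in> {(k, n). k \<ge> 1 \<and> q k * (\<Prod>i=k+1..k+n. b i) \<ge> int N}.
      ereal (ln (digit_prod q k n) / ln (scale_ratio b q k n)))"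

lemma digit_prod_0 [simp]: "digit_prod q k 0 = real_of_int (q k)"
  by (simp add: digit_prod_def)

lemma digit_prod_Suc [simp]: "digit_prod q k (Suc n) = digit_prod q k n * real_of_int (q (Suc (k + n)))"
  by (simp add: digit_prod_def)

lemma digit_prod_Suc_left: "digit_prod q k (Suc n) = real_of_int (q k) * digit_prod q (Suc k) n"
  by (induction n) simp_all

lemma scale_ratio_0 [simp]: "scale_ratio b q k 0 = real_of_int (q k)"
  by (simp add: scale_ratio_def)

lemma scale_ratio_Suc [simp]:
  "scale_ratio b q k (Suc n) = scale_ratio b q k n * real_of_int (b (Suc (k + n)))"
  by (simp add: scale_ratio_def)

lemma scale_ratio_Suc_left: "scale_ratio b q k (Suc n) = real_of_int (q k) * digit_prod b (Suc k) n"
  by (induction n) simp_all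

text \<open>Passes from critical radii to general ones. It rests on \<open>t \<le> t powr s\<close>
  for \<open>t\<close> in \<open>[0, 1]\<close>, which is where \<open>s \<le> 1\<close>
  enters.\<close>

lemma powr_scaling:
  fixes a c m s t :: real
  assumes "a \<le> c * m powr s" "0 \<le> a" "0 \<le> t" "t \<le> 1" "0 \<le> s" "s \<le> 1" "0 \<le> m"
  shows "a * t \<le> c * (m * t) powr s"
proof (cases "t = 0")
  case False
  have "t \<le> t powr s" using powr_mono'[of s 1 t] assms False by simp
  then have "a * t \<le> (c * m powr s) * t powr s"
    using assms by (intro mult_mono) auto
  then show ?thesis using assms by (simp add: powr_mult)
qed simp

context moran_sequences
begin

lemma digit_prod_eq: "digit_prod q (Suc j) n = Q (Suc j + n) / Q j"
proof (induction n)
  case 0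
  show ?case by simp
qed (simp add: field_simps)

text \<open>The right side is the quotient of the critical radii
  \<open>q (Suc j) / P (Suc j)\<close> and \<open>1 / P (Suc j + n)\<close>.\<close>

lemma scale_ratio_eq:
  "scale_ratio b q (Suc j) n = real_of_int (q (Suc j)) * P (Suc j + n) / P (Suc j)"
proof (induction n)
  case 0
  show ?case using P_nz[of "Suc j"] by (simp del: partial_prod_Suc)
next
  case (Suc n)
  then show ?case unfolding scale_ratio_Suc by (simp del: partial_prod_Suc add: partial_prod_Suc[of _ "Suc (j + n)"])
qed

lemma digit_prod_ge: "2 \<le> digit_prod q (Suc j) n"
proof (induction n)
  case 0
  show ?case using q_ge[of j] by (simp add: digit_prod_def)
next
  case (Suc n)
  have "2 * 1 \<le> digit_prod q (Suc j) n * real_of_int (q (Suc (Suc j + n)))"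
    using Suc q_ge[of "Suc j + n"] by (intro mult_mono) auto
  then show ?case by simp
qed

lemma digit_prod_le_scale_ratio: "digit_prod q (Suc j) n \<le> scale_ratio b q (Suc j) n"
proof (induction n)
  case 0
  show ?case by (simp add: digit_prod_def)
next
  case (Suc n)
  show ?case unfolding digit_prod_Suc scale_ratio_Suc
    using Suc q_less[of "Suc j + n"] q_ge[of "Suc j + n"] digit_prod_ge[of j n]
    by (intro mult_mono) auto
qed

lemma scale_ratio_ge: "2 ^ Suc n \<le> scale_ratio b q (Suc j) n"
proof (induction n)
  case 0
  show ?case using q_ge[of j] by simp
next
  case (Suc n)
  have "2 ^ Suc n * 2 \<le> scale_ratio b q (Suc j) n * real_of_int (b (Suc (Suc j + n)))"
    using Suc b_ge[of "Suc j + n"] order_trans[OF _ Suc, of 0] by (intro mult_mono) auto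
  then show ?case by simp
qed

section \<open>Quotients of ball measures against block products\<close>

lemma ex_level:
  assumes "0 < R" "R < 1"
  obtains k where "1 / P (Suc k) \<le> R" "R < 1 / P k"
proof -
  obtain n where n: "1 / P n < R" using ex_inverse_P_less[OF assms(1)] by blast
  define m where "m = (LEAST n. 1 / P n \<le> R)"
  have m: "1 / P m \<le> R" unfolding m_def by (rule LeastI[of _ n]) (use n in simp)
  then have "m \<noteq> 0" using assms(2) by (intro notI) simp
  then obtain k where k: "m = Suc k" by (cases m) auto
  have "\<not> 1 / P k \<le> R" using not_less_Least[of k "\<lambda>n. 1 / P n \<le> R"] k unfolding m_def by simp
  then show ?thesis using that m k by auto
qed

text \<open>With \<open>R\<close> at level \<open>k\<close> and \<open>r\<close> at level
  \<open>l\<close>, the ball estimates bound the quotient by 8 times an expression in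
  \<open>u\<close> and \<open>w\<close>, the two ball masses in units of cylinders. That expression
  is a block product \<open>a\<close> shrunk by a factor \<open>t\<close>, and the same
  \<open>t\<close> shrinks \<open>scale_ratio\<close> to at most \<open>R / r\<close>.\<close>

lemma ball_ratio_le:
  assumes s: "0 \<le> s" "s \<le> 1" and C: "1 \<le> C"
    and bound: "\<And>j n. digit_prod q (Suc j) n \<le> C * scale_ratio b q (Suc j) n powr s"
    and x: "x \<in> measure_support \<mu>" and r: "0 < r" "r < R" "R < 1"
  shows "measure \<mu> (ball x R) / measure \<mu> (ball x r) \<le> 8 * C * (R / r) powr s"
proof -
  obtain k where k: "1 / P (Suc k) \<le> R" "R < 1 / P k" using ex_level[of R] r by force
  obtain l where l: "1 / P (Suc l) \<le> r" "r < 1 / P l" using ex_level[of r] r by force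
  have kl: "k \<le> l"
  proof (rule ccontr)
    assume "\<not> k \<le> l"
    then have "1 / P k \<le> 1 / P (Suc l)" by (intro antimono_inverse_P) simp
    then show False using k l r by linarith
  qed
  define p p' where "p = P (Suc k)" and "p' = P (Suc l)"
  have p: "0 < p" "0 < p'" unfolding p_def p'_def by (rule P_pos)+
  define d d' where "d = real_of_int (q (Suc k))" and "d' = real_of_int (q (Suc l))"
  have d: "2 \<le> d" "2 \<le> d'" using q_ge[of k] q_ge[of l] unfolding d_def d'_def by auto
  define u w where "u = min d (R * p)" and "w = min d' (r * p')"
  have "1 \<le> R * p" "1 \<le> r * p'" using k(1) l(1) p unfolding p_def[symmetric] p'_def[symmetric]
    by (simp_all add: field_simps)
  then have uw: "1 \<le> u" "1 \<le> w" using d unfolding u_def w_def by auto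
  have u: "u \<le> d" "u / p \<le> R" unfolding u_def using p by (auto simp: min_def field_simps)
  have Q: "Q (Suc k) = Q k * d" "Q (Suc l) = Q l * d'" by (simp_all add: d_def d'_def)
  have Q': "0 < Q k" "0 < Q l" "0 < P l" by simp_all
  have Rr: "1 \<le> R / r" using r by simp
  have "measure \<mu> (ball x R) \<le> 4 * u / (Q k * d)"
    using measure_ball_le_min[OF k(1) less_imp_le[OF k(2)], of x] unfolding u_def d_def p_def Q .
  moreover have "w / (2 * (Q l * d')) \<le> measure \<mu> (ball x r)"
    using measure_ball_ge[OF x l(1)] unfolding w_def d'_def p'_def Q .
  moreover have "0 < w / (2 * (Q l * d'))" using uw d Q' by (intro divide_pos_pos mult_pos_pos) auto
  ultimately have "measure \<mu> (ball x R) / measure \<mu> (ball x r) \<le>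
      (4 * u / (Q k * d)) / (w / (2 * (Q l * d')))"
    using uw d Q' by (intro frac_le) auto
  also have "\<dots> = 8 * (u * (Q l * d') / (Q k * d * w))"
    using uw d Q' by (simp add: field_simps)
  also have "u * (Q l * d') / (Q k * d * w) \<le> C * (R / r) powr s"
  proof (cases "r * p' \<le> d'")
    case True
    then have w: "w = r * p'" by (simp add: w_def min_def)
    \<comment> \<open>Here \<open>u / d\<close> accounts for \<open>R\<close> below its critical
      value and \<open>1 / w\<close> for \<open>r\<close> above \<open>1 / p'\<close>.\<close>
    define t where "t = u / d / w"
    have t: "0 \<le> t" "t \<le> 1"
    proof -
      have "u \<le> d * w" using mult_mono[of u d 1 w] u uw d by simp
      then show "0 \<le> t" "t \<le> 1" using u uw d unfolding t_def by (auto simp: field_simps)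
    qed
    define a m where "a = digit_prod q (Suc k) (l - k)" and "m = scale_ratio b q (Suc k) (l - k)"
    have am: "a = Q l * d' / Q k" "m = d * p' / p"
      unfolding a_def m_def digit_prod_eq scale_ratio_eq using kl by (simp_all add: d_def d'_def p_def p'_def)
    have "a * t \<le> C * (m * t) powr s"
      using bound[of k "l - k"] s t am Q' d p unfolding a_def[symmetric] m_def[symmetric]
      by (intro powr_scaling) auto
    also have "m * t = u / p / r" unfolding am t_def w using d p r by (simp add: field_simps)
    also have "C * (u / p / r) powr s \<le> C * (R / r) powr s"
      using C s u uw p r by (intro mult_left_mono powr_mono2 divide_right_mono) auto
    also have "a * t = u * (Q l * d') / (Q k * d * w)" unfolding am t_def by (simp add: mult_ac)
    finally show ?thesis .
  next
    case False
    \<comment> \<open>On this plateau the lower bound for the small ball is already that for radius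
      \<open>1 / P l\<close>, which exceeds \<open>r\<close>. The block therefore ends at
      \<open>l\<close> instead of \<open>Suc l\<close>, and is empty when
      \<open>k = l\<close>.\<close>
    then have w: "w = d'" by (simp add: w_def)
    show ?thesis
    proof (cases "k = l")
      case True
      have "u * (Q l * d') / (Q k * d * w) = u / d" unfolding w True using d Q' by simp
      also have "\<dots> \<le> 1 * 1" using u d by simp
      also have "\<dots> \<le> C * (R / r) powr s"
        using C ge_one_powr_ge_zero[OF Rr s(1)] by (intro mult_mono) auto
      finally show ?thesis .
    next
      case False
      then obtain n where n: "l = Suc (k + n)" using kl less_imp_Suc_add[of k l] by auto
      define t where "t = u / d"
      have t: "0 \<le> t" "t \<le> 1" using u uw d unfolding t_def by auto
      define a m where "a = digit_prod q (Suc k) n" and "m = scale_ratio b q (Suc k) n"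
      have am: "a = Q l / Q k" "m = d * P l / p"
        unfolding a_def m_def digit_prod_eq scale_ratio_eq n by (simp_all add: d_def p_def)
      have "a * t \<le> C * (m * t) powr s"
        using bound[of k n] s t am Q' d p unfolding a_def[symmetric] m_def[symmetric]
        by (intro powr_scaling) auto
      also have "m * t = u / p * P l" unfolding am t_def using d p by (simp add: field_simps)
      also have "C * (u / p * P l) powr s \<le> C * (R / r) powr s"
      proof (intro mult_left_mono powr_mono2)
        have "u / p * P l \<le> R * P l" using u Q' by (intro mult_right_mono) auto
        also have "\<dots> \<le> R * (1 / r)" using l(2) r Q'
          by (intro mult_left_mono) (auto simp: field_simps)
        finally show "u / p * P l \<le> R / r" by simp
      qed (use C s u uw p Q' in auto)
      also have "a * t = u * (Q l * d') / (Q k * d * w)" unfolding am t_def w using d by simp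
      finally show ?thesis .
    qed
  qed
  finally show ?thesis by simp
qed

text \<open>The hypothesis is tested at the point 0 of the support. The constant 16 is the product
  of the 4 lost in \<open>lower\<close> and the 4 lost in \<open>upper\<close>.\<close>

lemma digit_prod_le_of_ball_ratio:
  assumes "0 \<le> s" "0 < C"
    and ratio: "\<And>x r R. x \<in> measure_support \<mu> \<Longrightarrow> 0 < r \<Longrightarrow> r < R \<Longrightarrow>
      R < diameter (measure_support \<mu>) \<Longrightarrow>
      measure \<mu> (ball x R) / measure \<mu> (ball x r) \<le> C * (R / r) powr s"
    and gt: "2 < scale_ratio b q (Suc j) n"
  shows "digit_prod q (Suc j) n \<le> 16 * C * scale_ratio b q (Suc j) n powr s"
proof -
  define m where "m = scale_ratio b q (Suc j) n"
  define p d where "p = P (Suc j)" and "d = real_of_int (q (Suc j))"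
  have d: "2 \<le> d" using q_ge[of j] unfolding d_def by simp
  have p: "0 < p" unfolding p_def by (rule P_pos)
  define p' where "p' = P (Suc (j + n))"
  have p': "0 < p'" unfolding p'_def by (rule P_pos)
  have m: "m = d * p' / p" unfolding m_def scale_ratio_eq d_def p_def p'_def by simp
  (* Half of the critical radius: for k = 1 the radius q k / P k may exceed the diameter. *)
  define R r where "R = d / (2 * p)" and "r = 1 / p'"
  have Rr: "R / r = m / 2" unfolding R_def r_def m using p p' by (simp add: field_simps)
  have r: "0 < r" using p' unfolding r_def by simp
  \<comment> \<open>Halving the critical radius is paid for here: \<open>r < R\<close> needs a scale
    ratio above 2.\<close>
  have "1 < R / r" using gt unfolding Rr m_def[symmetric] by simp
  then have rR: "r < R" using r by (simp add: field_simps)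
  have "d / p \<le> real_of_int (q 1) / real_of_int (b 1)"
  proof (cases j)
    case 0
    then show ?thesis by (simp add: d_def p_def)
  next
    case (Suc i)
    have "d / p < 1 / P j" unfolding d_def p_def by (rule tail_width_less)
    also have "\<dots> \<le> 1 / P 1" using Suc by (intro antimono_inverse_P) simp
    also have "\<dots> \<le> real_of_int (q 1) / real_of_int (b 1)"
      using q_ge[of 0] b_ge[of 0] by (simp add: divide_right_mono)
    finally show ?thesis by simp
  qed
  then have "R \<le> real_of_int (q 1) / (2 * real_of_int (b 1))" unfolding R_def by simp
  then have Rdiam: "R < diameter (measure_support \<mu>)" using diameter_support_greater by linarith
  have supp: "0 \<in> measure_support \<mu>" by (rule zero_in_support)
  have R1: "1 / p \<le> R" using d p unfolding R_def by (simp add: field_simps)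
  have "min d (R * p) / (2 * (Q j * d)) \<le> measure \<mu> (ball 0 R)"
    using measure_ball_ge[OF supp R1[unfolded p_def]] unfolding p_def[symmetric] partial_prod_Suc[of q]
      d_def[symmetric] .
  moreover have "min d (R * p) = d / 2" using p d unfolding R_def by simp
  ultimately have lower: "1 / (4 * Q j) \<le> measure \<mu> (ball 0 R)" using d by (simp add: field_simps)
  have r1: "1 / P (Suc (j + n)) \<le> r" "r \<le> 1 / P (j + n)"
    using antimono_inverse_P[of "j + n" "Suc (j + n)"] unfolding r_def p'_def by simp_all
  have "measure \<mu> (ball 0 r) \<le> 4 * min (real_of_int (q (Suc (j + n)))) (r * p') / Q (Suc (j + n))"
    using measure_ball_le_min[OF r1] unfolding p'_def .
  also have "\<dots> \<le> 4 * 1 / Q (Suc (j + n))"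
    using p' by (intro divide_right_mono mult_left_mono less_imp_le[OF Q_pos]) (auto simp: r_def)
  finally have upper: "measure \<mu> (ball 0 r) \<le> 4 / Q (Suc (j + n))" by simp
  have "0 < min (real_of_int (q (Suc (j + n)))) (r * P (Suc (j + n))) / (2 * Q (Suc (j + n)))"
    using q_ge[of "j + n"] r P_pos[of "Suc (j + n)"] Q_pos[of "Suc (j + n)"]
    by (intro divide_pos_pos mult_pos_pos) (auto simp: min_def simp del: partial_prod_Suc)
  then have pos: "0 < measure \<mu> (ball 0 r)" using measure_ball_ge[OF supp r1(1)] by linarith
  have "digit_prod q (Suc j) n = 16 * ((1 / (4 * Q j)) / (4 / Q (Suc (j + n))))"
    unfolding digit_prod_eq by (simp del: partial_prod_Suc)
  also have "(1 / (4 * Q j)) / (4 / Q (Suc (j + n))) \<le> measure \<mu> (ball 0 R) / measure \<mu> (ball 0 r)"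
    using lower upper pos less_imp_le[OF Q_pos, of j] by (intro frac_le) auto
  also have "\<dots> \<le> C * (R / r) powr s" by (rule ratio[OF supp r rR Rdiam])
  also have "\<dots> \<le> C * m powr s"
    unfolding Rr using gt assms unfolding m_def by (intro mult_left_mono powr_mono2) auto
  finally show ?thesis unfolding m_def by simp
qed

section \<open>The rate and its limit\<close>

lemma scale_ratio_int: "int N \<le> q k * (\<Prod>i=k+1..k+n. b i) \<longleftrightarrow> real N \<le> scale_ratio b q k n"
  unfolding scale_ratio_def using of_int_le_iff[where 'a=real, of "int N"]
  unfolding of_int_of_nat_eq by (rule sym)

lemma moran_rate_eq:
  "moran_rate b q N = (SUP (j, n) \<in> {(j, n). real N \<le> scale_ratio b q (Suc j) n}.
    ereal (ln (digit_prod q (Suc j) n) / ln (scale_ratio b q (Suc j) n)))"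
proof -
  have "{(k, n). k \<ge> 1 \<and> q k * (\<Prod>i=k+1..k+n. b i) \<ge> int N} =
      (\<lambda>(j, n). (Suc j, n)) ` {(j, n). real N \<le> scale_ratio b q (Suc j) n}"
    unfolding scale_ratio_int
  proof (intro equalityI subsetI)
    fix x assume x: "x \<in> {(k, n). k \<ge> 1 \<and> real N \<le> scale_ratio b q k n}"
    then show "x \<in> (\<lambda>(j, n). (Suc j, n)) ` {(j, n). real N \<le> scale_ratio b q (Suc j) n}"
      by (intro image_eqI[of _ _ "(fst x - 1, snd x)"]) auto
  qed auto
  then show ?thesis unfolding moran_rate_def by (simp add: image_image case_prod_beta)
qed

lemma moran_rate_leI:
  assumes "\<And>j n. real N \<le> scale_ratio b q (Suc j) n \<Longrightarrow>
    ereal (ln (digit_prod q (Suc j) n) / ln (scale_ratio b q (Suc j) n)) \<le> c"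
  shows "moran_rate b q N \<le> c"
  unfolding moran_rate_eq by (rule SUP_least) (use assms in auto)

lemma le_moran_rate:
  assumes "real N \<le> scale_ratio b q (Suc j) n"
  shows "ereal (ln (digit_prod q (Suc j) n) / ln (scale_ratio b q (Suc j) n)) \<le> moran_rate b q N"
  unfolding moran_rate_eq by (rule SUP_upper2[of "(j, n)"]) (use assms in auto)

text \<open>Raising \<open>N\<close> shrinks the index set. Hence the limit in \<open>N\<close> is
  the infimum, the form used from here on.\<close>

lemma decseq_moran_rate: "decseq (moran_rate b q)"
  by (rule decseq_SucI) (rule moran_rate_leI, rule le_moran_rate, simp)

lemma ln_digit_prod_pos: "0 < ln (digit_prod q (Suc j) n)"
  using digit_prod_ge[of j n] by (intro ln_gt_zero) simp

lemma scale_ratio_ge_2: "2 \<le> scale_ratio b q (Suc j) n"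
  using digit_prod_ge[of j n] digit_prod_le_scale_ratio[of j n] by linarith

lemma ln_scale_ratio_pos: "0 < ln (scale_ratio b q (Suc j) n)"
  using scale_ratio_ge_2[of j n] by (intro ln_gt_zero) simp

lemma moran_rate_le_1: "moran_rate b q N \<le> 1"
proof (rule moran_rate_leI)
  fix j n
  have "ln (digit_prod q (Suc j) n) \<le> ln (scale_ratio b q (Suc j) n)"
    using digit_prod_le_scale_ratio[of j n] digit_prod_ge[of j n] by (intro ln_mono) auto
  then show "ereal (ln (digit_prod q (Suc j) n) / ln (scale_ratio b q (Suc j) n)) \<le> 1"
    using ln_scale_ratio_pos[of j n] by (simp add: one_ereal_def)
qed

lemma moran_rate_nonneg: "0 \<le> moran_rate b q N"
proof -
  obtain n where "real N < 2 ^ n" using real_arch_pow[of 2 "real N"] by auto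
  moreover have "(2::real) ^ n \<le> 2 ^ Suc n" by simp
  ultimately have "real N \<le> scale_ratio b q (Suc 0) n"
    using scale_ratio_ge[of n 0] by linarith
  from le_moran_rate[OF this] show ?thesis
    using ln_scale_ratio_pos[of 0 n] ln_digit_prod_pos[of 0 n]
    by (elim order_trans[rotated]) (simp add: zero_ereal_def)
qed

text \<open>Taking logarithms turns the factor \<open>K\<close> into an error
  \<open>ln K / ln m\<close> with \<open>m\<close> at least \<open>N\<close>, which vanishes as
  \<open>N\<close> grows.\<close>

lemma INF_moran_rate_le:
  assumes K: "0 < K"
    and le: "\<And>j n. 2 < scale_ratio b q (Suc j) n \<Longrightarrow>
      digit_prod q (Suc j) n \<le> K * scale_ratio b q (Suc j) n powr s"
  shows "(INF N. moran_rate b q N) \<le> ereal s"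
proof (rule LIMSEQ_le[OF LIMSEQ_INF[OF decseq_moran_rate]])
  \<comment> \<open>Truncation at 0 makes \<open>c / ln m\<close> decreasing in \<open>m\<close>
    even when \<open>K < 1\<close>.\<close>
  define c where "c = max 0 (ln K)"
  have "(\<lambda>N. s + c / ln (real N)) \<longlonglongrightarrow> s + 0"
    by (intro tendsto_intros real_tendsto_divide_at_top[OF tendsto_const]
        filterlim_compose[OF ln_at_top filterlim_real_sequentially])
  then show "(\<lambda>N. ereal (s + c / ln (real N))) \<longlonglongrightarrow> ereal s" by simp
  \<comment> \<open>From \<open>N = 3\<close> on, every admissible scale ratio exceeds 2, as
    \<open>le\<close> demands.\<close>
  have "moran_rate b q N \<le> ereal (s + c / ln (real N))" if N: "3 \<le> N" for N
  proof (rule moran_rate_leI)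
    fix j n
    let ?a = "digit_prod q (Suc j) n" and ?m = "scale_ratio b q (Suc j) n"
    assume m: "real N \<le> ?m"
    have "ln ?a \<le> ln (K * ?m powr s)"
      using le[of j n] m N digit_prod_ge[of j n] by (intro ln_mono) auto
    also have "\<dots> = ln K + s * ln ?m" using K m N by (simp add: ln_mult ln_powr)
    also have "\<dots> \<le> c + s * ln ?m" by (simp add: c_def)
    finally have "ln ?a / ln ?m \<le> (c + s * ln ?m) / ln ?m"
      using ln_scale_ratio_pos[of j n] by (intro divide_right_mono) auto
    also have "\<dots> = s + c / ln ?m" using ln_scale_ratio_pos[of j n] by (simp add: field_simps)
    also have "\<dots> \<le> s + c / ln (real N)"
      using m N by (intro add_left_mono divide_left_mono ln_mono) (auto simp: c_def)
    finally show "ereal (ln ?a / ln ?m) \<le> ereal (s + c / ln (real N))" by simp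
  qed
  then show "\<exists>N. \<forall>n\<ge>N. moran_rate b q n \<le> ereal (s + c / ln (real n))" by blast
qed

lemma assouad_dim_le:
  assumes "0 \<le> s" "s \<le> 1" "1 \<le> C"
    and "\<And>j n. digit_prod q (Suc j) n \<le> C * scale_ratio b q (Suc j) n powr s"
  shows "assouad_dim \<mu> \<le> ereal s"
  unfolding assouad_dim_def
proof (rule Inf_lower, clarify, intro exI conjI refl)
  show "\<forall>x\<in>measure_support \<mu>. \<forall>r R. 0 < r \<and> r < R \<and> R < diameter (measure_support \<mu>) \<longrightarrow>
      measure \<mu> (ball x R) / measure \<mu> (ball x r) \<le> 8 * C * (R / r) powr s"
    using ball_ratio_le[OF assms] diameter_support_le by force
qed (use assms in auto)

text \<open>Above: for \<open>t < 1\<close> beyond the infimum, some \<open>N\<close> controls all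
  blocks of scale ratio at least \<open>N\<close>, and the constant absorbs the others; exponents
  from 1 on follow from \<open>digit_prod_le_scale_ratio\<close>. Below: each admissible exponent
  bounds the block products, hence the rate.\<close>

lemma assouad_dim_moran: "assouad_dim \<mu> = (INF N. moran_rate b q N)"
proof (rule antisym)
  show "assouad_dim \<mu> \<le> (INF N. moran_rate b q N)"
  proof (rule dense_ge)
    fix z assume z: "(INF N. moran_rate b q N) < z"
    have le1: "assouad_dim \<mu> \<le> 1" unfolding one_ereal_def
      by (rule assouad_dim_le[of 1 1])
        (use digit_prod_le_scale_ratio scale_ratio_ge_2[THEN order_trans[of 0, rotated]] in auto)
    show "assouad_dim \<mu> \<le> z"
    proof (cases "1 \<le> z")
      case True
      then show ?thesis using le1 by (rule order_trans[rotated])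
    next
      case False
      obtain N where N: "moran_rate b q N < z" using z by (auto simp: INF_less_iff)
      then have "0 < z" using moran_rate_nonneg[of N] by (rule le_less_trans[rotated])
      then obtain t where t: "z = ereal t" "0 < t" "t < 1" using False by (cases z) auto
      have "assouad_dim \<mu> \<le> ereal t"
      proof (rule assouad_dim_le[of t "max 1 (real N)"])
        fix j n
        let ?a = "digit_prod q (Suc j) n" and ?m = "scale_ratio b q (Suc j) n"
        have m1: "1 \<le> ?m powr t" using scale_ratio_ge_2[of j n] t by (intro ge_one_powr_ge_zero) auto
        show "?a \<le> max 1 (real N) * ?m powr t"
        proof (cases "real N \<le> ?m")
          case True
          then have "ereal (ln ?a / ln ?m) < ereal t"
            using le_moran_rate N t(1) by (metis order_le_less_trans)
          then have "ln ?a \<le> t * ln ?m" using ln_scale_ratio_pos[of j n] by (simp add: field_simps)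
          also have "\<dots> = ln (?m powr t)" using scale_ratio_ge_2[of j n] by (simp add: ln_powr)
          finally have "?a \<le> ?m powr t"
            using digit_prod_ge[of j n] m1 by (subst (asm) ln_le_cancel_iff) auto
          also have "\<dots> \<le> max 1 (real N) * ?m powr t"
            using m1 mult_right_mono[of 1 "max 1 (real N)" "?m powr t"] by simp
          finally show ?thesis .
        next
          case False
          \<comment> \<open>A block of small scale ratio has an even smaller digit product, so the
            constant \<open>N\<close> suffices.\<close>
          then have "?a \<le> real N * 1" using digit_prod_le_scale_ratio[of j n] by simp
          also have "\<dots> \<le> max 1 (real N) * ?m powr t" using m1 by (intro mult_mono) auto
          finally show ?thesis .
        qed
      qed (use t in auto)
      then show ?thesis using t by simp
    qed
  qed
  show "(INF N. moran_rate b q N) \<le> assouad_dim \<mu>"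
    unfolding assouad_dim_def
  proof (rule Inf_greatest, clarify)
    fix s C :: real
    assume s: "0 \<le> s" and C: "0 < C"
      and "\<forall>x\<in>measure_support \<mu>. \<forall>r R. 0 < r \<and> r < R \<and> R < diameter (measure_support \<mu>) \<longrightarrow>
        measure \<mu> (ball x R) / measure \<mu> (ball x r) \<le> C * (R / r) powr s"
    then show "(INF N. moran_rate b q N) \<le> ereal s"
      by (intro INF_moran_rate_le[of "16 * C"] digit_prod_le_of_ball_ratio) auto
  qed
qed

section \<open>Bounded and unbounded digits\<close>

lemma scale_ratio_le_digit_prod: "scale_ratio b q (Suc j) n \<le> digit_prod b (Suc j) n"
proof (induction n)
  case 0
  show ?case using q_less[of j] by simp
next
  case (Suc n)
  then show ?case using b_ge[of "Suc j + n"] by (simp add: mult_right_mono)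
qed

lemma digit_prod_b_ge: "2 \<le> digit_prod b (Suc j) n"
  using scale_ratio_le_digit_prod scale_ratio_ge_2 by (rule order_trans[rotated])

lemma SUP_digit_prod:
  "(SUP k\<in>{1..}. ereal (ln (digit_prod q k n) / ln (digit_prod b k n))) =
    (SUP j. ereal (ln (digit_prod q (Suc j) n) / ln (digit_prod b (Suc j) n)))"
proof -
  have "{1..} = range Suc" using atLeast_Suc_greaterThan greaterThan_0 by simp
  then show ?thesis by (simp only: image_image)
qed

text \<open>Replacing \<open>q k\<close> by \<open>b k\<close> in the denominator lowers the
  quotient, and a block with parameter \<open>n\<close> has scale ratio at least
  \<open>2 ^ Suc n\<close>, so it is admissible for \<open>N = Suc n\<close>.\<close>

lemma limsup_digit_prod_le:
  "limsup (\<lambda>n. SUP k\<in>{1..}. ereal (ln (digit_prod q k n) / ln (digit_prod b k n))) \<le>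
    (INF N. moran_rate b q N)" (is "limsup ?G \<le> _")
proof -
  have "?G n \<le> moran_rate b q (Suc n)" for n
    unfolding SUP_digit_prod
  proof (rule SUP_least)
    fix j
    have "real (Suc n) \<le> 2 ^ Suc n" using of_nat_less_two_power[of "Suc n", where 'a=real] by linarith
    then have "ereal (ln (digit_prod q (Suc j) n) / ln (scale_ratio b q (Suc j) n)) \<le> moran_rate b q (Suc n)"
      using scale_ratio_ge[of n j] by (intro le_moran_rate) linarith
    moreover have "ln (digit_prod q (Suc j) n) / ln (digit_prod b (Suc j) n) \<le>
        ln (digit_prod q (Suc j) n) / ln (scale_ratio b q (Suc j) n)"
      using ln_digit_prod_pos[of j n] ln_scale_ratio_pos[of j n] scale_ratio_le_digit_prod[of j n]
        scale_ratio_ge_2[of j n]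
      by (intro divide_left_mono ln_mono mult_pos_pos) auto
    ultimately show "ereal (ln (digit_prod q (Suc j) n) / ln (digit_prod b (Suc j) n)) \<le> moran_rate b q (Suc n)"
      by (meson ereal_less_eq(3) order_trans)
  qed
  then have "limsup ?G \<le> limsup (\<lambda>n. moran_rate b q (Suc n))" by (intro Limsup_mono always_eventually allI)
  also have "\<dots> = (INF N. moran_rate b q N)"
    by (intro lim_imp_Limsup LIMSEQ_Suc LIMSEQ_INF decseq_moran_rate) simp
  finally show ?thesis .
qed

text \<open>With bounded digits the first factor of a block costs only a constant, so the bound for the
  blocks of \<open>b\<close> starting at \<open>k + 1\<close> yields one for the blocks of \<open>scale_ratio\<close> starting at \<open>k\<close>.\<close>

lemma INF_moran_rate_le_of_digit_prod:
  assumes B: "\<And>j. real_of_int (q (Suc j)) \<le> B" and t: "0 \<le> t"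
    and le: "\<And>j n. n0 \<le> n \<Longrightarrow> digit_prod q (Suc j) n \<le> digit_prod b (Suc j) n powr t"
  shows "(INF N. moran_rate b q N) \<le> ereal t"
proof (rule INF_moran_rate_le)
  have B2: "2 \<le> B" using B[of 0] q_ge[of 0] by simp
  \<comment> \<open>One constant for both cases: it bounds the digit products with
    \<open>n \<le> n0\<close>, and for longer blocks it dominates the factor \<open>B\<close> of the
    detached first digit.\<close>
  then show "0 < B ^ Suc n0" by simp
  fix j n
  let ?m = "scale_ratio b q (Suc j) n"
  have m: "1 \<le> ?m powr t" using scale_ratio_ge_2[of j n] t by (intro ge_one_powr_ge_zero) auto
  have small: "digit_prod q (Suc j) n \<le> B ^ Suc n" for n
  proof (induction n)
    case 0
    show ?case using B[of j] by simp
  next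
    case (Suc n)
    have "digit_prod q (Suc j) n * real_of_int (q (Suc (Suc j + n))) \<le> B ^ Suc n * B"
      using Suc B[of "Suc j + n"] q_ge[of "Suc j + n"] B2 by (intro mult_mono) auto
    then show ?case by (simp add: mult.commute)
  qed
  show "digit_prod q (Suc j) n \<le> B ^ Suc n0 * ?m powr t"
  proof (cases "n \<le> n0")
    case True
    have "B ^ Suc n * 1 \<le> B ^ Suc n0 * ?m powr t"
      using True B2 m by (intro mult_mono power_increasing) auto
    then show ?thesis using small[of n] by linarith
  next
    case False
    then obtain i where n: "n = Suc i" "n0 \<le> i" by (cases n) auto
    define x where "x = digit_prod b (Suc (Suc j)) i"
    have x: "2 \<le> x" unfolding x_def by (rule digit_prod_b_ge)
    have "?m = real_of_int (q (Suc j)) * x" unfolding n(1) x_def by (rule scale_ratio_Suc_left)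
    also have "\<dots> \<ge> 1 * x" using q_ge[of j] x by (intro mult_right_mono) auto
    finally have xm: "x \<le> ?m" by simp
    have "digit_prod q (Suc j) n = real_of_int (q (Suc j)) * digit_prod q (Suc (Suc j)) i"
      unfolding n(1) by (rule digit_prod_Suc_left)
    also have "\<dots> \<le> B * x powr t"
      using B[of j] le[OF n(2), of "Suc j"] B2 digit_prod_ge[of "Suc j" i]
      unfolding x_def by (intro mult_mono) auto
    also have "\<dots> \<le> B ^ Suc n0 * ?m powr t"
    proof (intro mult_mono powr_mono2)
      show "B \<le> B ^ Suc n0" using power_increasing[of 1 "Suc n0" B] B2 by simp
    qed (use B2 t x xm in auto)
    finally show ?thesis .
  qed
qed

text \<open>For the remaining inequality, a number \<open>t\<close> above the limsup bounds the
  quotients for all \<open>n\<close> from some \<open>n0\<close> on, uniformly in \<open>j\<close>;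
  exponentiating gives the hypothesis of \<open>INF_moran_rate_le_of_digit_prod\<close>.\<close>

lemma limsup_digit_prod:
  assumes "bounded ((\<lambda>n. real_of_int (q n)) ` {1..})"
  shows "limsup (\<lambda>n. SUP k\<in>{1..}. ereal (ln (digit_prod q k n) / ln (digit_prod b k n))) =
    (INF N. moran_rate b q N)" (is "limsup ?G = _")
proof (rule antisym[OF limsup_digit_prod_le])
  have ln_b: "0 < ln (digit_prod b (Suc j) n)" for j n
    using digit_prod_b_ge[of j n] by (intro ln_gt_zero) simp
  have le_G: "ereal (ln (digit_prod q (Suc j) n) / ln (digit_prod b (Suc j) n)) \<le> ?G n" for j n
    unfolding SUP_digit_prod by (rule SUP_upper) simp
  obtain B where "\<forall>x\<in>(\<lambda>n. real_of_int (q n)) ` {1..}. norm x \<le> B"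
    using assms unfolding bounded_iff by blast
  then have B: "real_of_int (q (Suc j)) \<le> B" for j by (auto simp: abs_le_iff)
  show "(INF N. moran_rate b q N) \<le> limsup ?G"
  proof (rule dense_ge)
    fix z assume z: "limsup ?G < z"
    show "(INF N. moran_rate b q N) \<le> z"
    proof (cases "z = \<infinity>")
      case False
      have "0 \<le> ?G n" for n
      proof (rule order_trans[OF _ le_G])
        show "0 \<le> ereal (ln (digit_prod q (Suc 0) n) / ln (digit_prod b (Suc 0) n))"
          using ln_digit_prod_pos[of 0 n] ln_b[of 0 n] by (simp add: zero_ereal_def)
      qed
      then have "0 \<le> limsup ?G" by (intro le_Limsup always_eventually allI) auto
      then have "0 < z" using z by (rule order_le_less_trans)
      then obtain t where t: "z = ereal t" "0 < t" using False by (cases z) auto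
      obtain n0 where n0: "\<And>n. n0 \<le> n \<Longrightarrow> ?G n < z"
        using Limsup_lessD[OF z] unfolding eventually_sequentially by blast
      have "digit_prod q (Suc j) n \<le> digit_prod b (Suc j) n powr t" if "n0 \<le> n" for j n
      proof -
        have bp: "2 \<le> digit_prod b (Suc j) n" by (rule digit_prod_b_ge)
        have "ereal (ln (digit_prod q (Suc j) n) / ln (digit_prod b (Suc j) n)) < ereal t"
          using order_le_less_trans[OF le_G n0[OF that]] unfolding t(1) .
        then have "ln (digit_prod q (Suc j) n) < t * ln (digit_prod b (Suc j) n)"
          using ln_b[of j n] by (simp add: divide_less_eq)
        also have "\<dots> = ln (digit_prod b (Suc j) n powr t)" using bp by (simp add: ln_powr)
        finally show ?thesis using bp digit_prod_ge[of j n] by (subst (asm) ln_less_cancel_iff) auto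
      qed
      then show ?thesis
        unfolding t(1) by (rule INF_moran_rate_le_of_digit_prod[OF B less_imp_le[OF t(2)]])
    qed simp
  qed
qed

text \<open>Blocks with \<open>n = 0\<close> suffice: numerator and denominator are both
  \<open>ln (q k)\<close>, and \<open>q k\<close> exceeds any \<open>N\<close> for some
  \<open>k\<close>.\<close>

lemma INF_moran_rate_unbounded:
  assumes "\<not> bounded ((\<lambda>n. real_of_int (q n)) ` {1..})"
  shows "(INF N. moran_rate b q N) = 1"
proof (rule antisym)
  show "(INF N. moran_rate b q N) \<le> 1" by (rule INF_lower2[of 0]) (simp_all add: moran_rate_le_1)
  show "1 \<le> (INF N. moran_rate b q N)"
  proof (rule INF_greatest)
    fix N
    have "\<exists>n\<ge>1. real N < real_of_int (q n)"
    proof (rule ccontr)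
      assume "\<not> ?thesis"
      then have *: "\<And>n. n \<ge> 1 \<Longrightarrow> real_of_int (q n) \<le> real N" by force
      have "norm (real_of_int (q n)) \<le> real N" if "n \<ge> 1" for n
        using *[OF that] bounds[OF that] by simp
      then have "bounded ((\<lambda>n. real_of_int (q n)) ` {1..})" unfolding bounded_iff by auto
      then show False using assms by contradiction
    qed
    then obtain j where j: "real N < real_of_int (q (Suc j))" by (metis Suc_le_D One_nat_def)
    have "ereal (ln (digit_prod q (Suc j) 0) / ln (scale_ratio b q (Suc j) 0)) \<le> moran_rate b q N"
      using j by (intro le_moran_rate) simp
    moreover have "ln (digit_prod q (Suc j) 0) / ln (scale_ratio b q (Suc j) 0) = 1"
      using ln_digit_prod_pos[of j 0] by (simp add: digit_prod_def)
    ultimately show "1 \<le> moran_rate b q N" by (simp add: one_ereal_def)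
  qed
qed

end

theorem proposition1p3:
  fixes b q :: "nat \<Rightarrow> int"
  assumes "\<And>n. n \<ge> 1 \<Longrightarrow> 2 \<le> q n \<and> q n < b n"
  shows "((\<lambda>N::nat. SUP (k, n) \<in> {(k::nat, n::nat). k \<ge> 1 \<and> q k * (\<Prod>i=k+1..k+n. b i) \<ge> int N}.
            ereal (ln (real_of_int (\<Prod>i=k..k+n. q i)) /
                   ln (real_of_int (q k * (\<Prod>i=k+1..k+n. b i)))))
          \<longlonglongrightarrow> assouad_dim (moran_measure b q))
       \<and> (bounded ((\<lambda>n. real_of_int (q n)) ` {1..}) \<longrightarrow>
            assouad_dim (moran_measure b q) =
              limsup (\<lambda>n. SUP k\<in>{1..}.
                ereal (ln (real_of_int (\<Prod>i=k..k+n. q i)) / ln (real_of_int (\<Prod>i=k..k+n. b i)))))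
       \<and> (\<not> bounded ((\<lambda>n. real_of_int (q n)) ` {1..}) \<longrightarrow> assouad_dim (moran_measure b q) = 1)"
proof -
  interpret moran_sequences b q using assms by unfold_locales
  have "moran_rate b q \<longlonglongrightarrow> assouad_dim \<mu>"
    unfolding assouad_dim_moran by (rule LIMSEQ_INF[OF decseq_moran_rate])
  then show ?thesis
    using limsup_digit_prod INF_moran_rate_unbounded
    unfolding moran_rate_def[abs_def] digit_prod_def[abs_def] scale_ratio_def[abs_def] assouad_dim_moran
    by simp
qed

end
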